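(* Let $\Omega\subset\mathbb{R}^n$, $n\ge1$, be a smooth bounded domain, let $p>1$, with $p<\frac{n+2}{n-2}$ when $n\ge3$, and let $e_k\in H^1_0(\Omega)$ be an eigenfunction of the Laplace operator $-\Delta$ with eigenvalue $\lambda_k$, that is $\Delta e_k+\lambda_ke_k=0$ in $\Omega$. Assume that $w\in L^2(\Omega)$ satisfies $$e_kw\ge0\ \text{ in }\Omega,\qquad \inf_\Omega|w|>\max\{\lambda_kt-t^p: t\ge0\}.$$ Let $\Omega_k\subseteq\Omega$ be a nodal region of $e_k$, that is $e_k|_{\Omega_k}\in H^1_0(\Omega_k)$, $e_k\ne0$ everywhere in $\Omega_k$ and the sign of $e_k$ is constant in $\Omega_k$. Then there exists no function $u\in H^1(\Omega)$ satisfying $$u\,e_k\ge0\quad\text{and}\quad-\Delta u=|u|^{p-1}u+w\quad\text{in }\Omega_k .$$ In particular, every solution $u$ of the problem $$-\Delta u=|u|^{p-1}u+w\ \text{ in }\Omega,\qquad u=0\ \text{ on }\partial\Omega$$ must satisfy $\inf_{\Omega_k}u<0$ if $e_k>0$ in $\Omega_k$, and $\sup_{\Omega_k}u>0$ if $e_k<0$ in $\Omega_k$.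
   Context: Equations are understood in the weak sense; inequalities, infima and suprema of Lebesgue/Sobolev functions are understood in the almost-everywhere (essential) sense. *)

theory Defs
  imports "HOL-Analysis.Analysis" "HOL-Probability.Essential_Supremum"
begin

section \<open>Smooth functions and smooth domains\<close>

text \<open>Only meaningful on open \<^term>\<open>S\<close>: all iterated directional derivatives up to order
  \<open>k\<close> exist and are continuous on \<^term>\<open>S\<close>.\<close>

fun Ck_on :: "nat \<Rightarrow> ('a::euclidean_space \<Rightarrow> 'b::real_normed_vector) \<Rightarrow> 'a set \<Rightarrow> bool" where
  "Ck_on 0 f S \<longleftrightarrow> continuous_on S f"
| "Ck_on (Suc k) f S \<longleftrightarrow> (\<forall>x\<in>S. f differentiable (at x)) \<and>
     (\<forall>v. Ck_on k (\<lambda>x. frechet_derivative f (at x) v) S)"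

definition smooth_on :: "('a::euclidean_space \<Rightarrow> 'b::real_normed_vector) \<Rightarrow> 'a set \<Rightarrow> bool" where
  "smooth_on f S \<longleftrightarrow> (\<forall>k. Ck_on k f S)"

text \<open>The boundary is locally the graph of a smooth function after rotating the coordinates:
  the unit vector \<open>\<nu>\<close> is the last axis, and \<open>y - (y \<bullet> \<nu>) *\<^sub>R \<nu>\<close> stands for the
  remaining coordinates of \<open>y\<close>.\<close>

definition smooth_boundary :: "'a::euclidean_space set \<Rightarrow> bool" where
  "smooth_boundary U \<longleftrightarrow>
     (\<forall>x\<in>frontier U. \<exists>r>0. \<exists>\<nu>. \<exists>\<gamma> :: 'a \<Rightarrow> real. norm \<nu> = 1 \<and> smooth_on \<gamma> UNIV \<and>
        U \<inter> ball x r = {y \<in> ball x r. y \<bullet> \<nu> > \<gamma> (y - (y \<bullet> \<nu>) *\<^sub>R \<nu>)})"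

definition smooth_bounded_domain :: "'a::euclidean_space set \<Rightarrow> bool" where
  "smooth_bounded_domain U \<longleftrightarrow>
     open U \<and> connected U \<and> U \<noteq> {} \<and> bounded U \<and> smooth_boundary U"

section \<open>Sobolev spaces\<close>

text \<open>Elements of function spaces over \<^term>\<open>U\<close> are represented by total functions, of which
  only the values on \<^term>\<open>U\<close> matter. Restriction to a smaller set is therefore implicit:
  \<open>f \<in> H10 V\<close> says that the restriction of \<open>f\<close> to \<open>V\<close> belongs to $H^1_0(V)$.
  All these notions are intended for open \<^term>\<open>U\<close>.\<close>

definition grad :: "('a::euclidean_space \<Rightarrow> real) \<Rightarrow> 'a \<Rightarrow> 'a" where
  "grad f x = (\<Sum>b\<in>Basis. frechet_derivative f (at x) b *\<^sub>R b)"

definition test_functions :: "'a::euclidean_space set \<Rightarrow> ('a \<Rightarrow> real) set" where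
  "test_functions U = {\<phi>. smooth_on \<phi> UNIV \<and>
     compact (closure {x. \<phi> x \<noteq> 0}) \<and> closure {x. \<phi> x \<noteq> 0} \<subseteq> U}"

definition locally_integrable ::
    "'a::euclidean_space set \<Rightarrow> ('a \<Rightarrow> 'b::euclidean_space) \<Rightarrow> bool" where
  "locally_integrable U f \<longleftrightarrow> (\<forall>K. compact K \<and> K \<subseteq> U \<longrightarrow> f absolutely_integrable_on K)"

definition L2 :: "'a::euclidean_space set \<Rightarrow> ('a \<Rightarrow> 'b::euclidean_space) set" where
  "L2 U = {f. f \<in> borel_measurable (lebesgue_on U) \<and>
     integrable (lebesgue_on U) (\<lambda>x. (norm (f x))\<^sup>2)}"

definition has_weak_gradient ::
    "'a::euclidean_space set \<Rightarrow> ('a \<Rightarrow> real) \<Rightarrow> ('a \<Rightarrow> 'a) \<Rightarrow> bool" where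
  "has_weak_gradient U f g \<longleftrightarrow> locally_integrable U f \<and> locally_integrable U g \<and>
     (\<forall>\<phi>\<in>test_functions U.
        (LINT x|lebesgue_on U. f x *\<^sub>R grad \<phi> x) = - (LINT x|lebesgue_on U. \<phi> x *\<^sub>R g x))"

definition H1 :: "'a::euclidean_space set \<Rightarrow> ('a \<Rightarrow> real) set" where
  "H1 U = {f \<in> L2 U. \<exists>g\<in>L2 U. has_weak_gradient U f g}"

text \<open>The closure of the test functions in the norm of \<^term>\<open>H1 U\<close>.\<close>

definition H10 :: "'a::euclidean_space set \<Rightarrow> ('a \<Rightarrow> real) set" where
  "H10 U = {f \<in> L2 U. \<exists>g\<in>L2 U. has_weak_gradient U f g \<and>
     (\<exists>\<phi> :: nat \<Rightarrow> 'a \<Rightarrow> real. (\<forall>n. \<phi> n \<in> test_functions U) \<and>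
        (\<lambda>n. LINT x|lebesgue_on U. (\<phi> n x - f x)\<^sup>2) \<longlonglongrightarrow> 0 \<and>
        (\<lambda>n. LINT x|lebesgue_on U. (norm (grad (\<phi> n) x - g x))\<^sup>2) \<longlonglongrightarrow> 0)}"

section \<open>Weak solutions, eigenfunctions and nodal regions\<close>

text \<open>The equation $-\Delta u = f$ in \<^term>\<open>U\<close>, in the weak sense. Since the weak gradient is
  unique almost everywhere, the existential quantifier is harmless. Local integrability of the
  right-hand side prevents the last integral from taking its default value.\<close>

definition weak_poisson ::
    "'a::euclidean_space set \<Rightarrow> ('a \<Rightarrow> real) \<Rightarrow> ('a \<Rightarrow> real) \<Rightarrow> bool" where
  "weak_poisson U u f \<longleftrightarrow> locally_integrable U f \<and>
     (\<exists>g. has_weak_gradient U u g \<and>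
        (\<forall>\<phi>\<in>test_functions U.
           (LINT x|lebesgue_on U. g x \<bullet> grad \<phi> x) = (LINT x|lebesgue_on U. f x * \<phi> x)))"

definition dirichlet_eigenfunction ::
    "'a::euclidean_space set \<Rightarrow> real \<Rightarrow> ('a \<Rightarrow> real) \<Rightarrow> bool" where
  "dirichlet_eigenfunction U lam e \<longleftrightarrow> e \<in> H10 U \<and> \<not> (AE x in lebesgue_on U. e x = 0) \<and>
     weak_poisson U e (\<lambda>x. lam * e x)"

text \<open>The conditions on the values of \<open>e\<close> in \<open>V\<close> are pointwise. They refer to the given
  representative, which may be, but need not be, the continuous one.\<close>

definition nodal_region ::
    "'a::euclidean_space set \<Rightarrow> ('a \<Rightarrow> real) \<Rightarrow> 'a set \<Rightarrow> bool" where
  "nodal_region U e V \<longleftrightarrow> open V \<and> V \<noteq> {} \<and> V \<subseteq> U \<and> e \<in> H10 V \<and>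
     (\<forall>x\<in>V. e x \<noteq> 0) \<and> ((\<forall>x\<in>V. 0 < e x) \<or> (\<forall>x\<in>V. e x < 0))"

section \<open>Essential extrema over a set\<close>

definition ess_sup_on :: "'a::euclidean_space set \<Rightarrow> ('a \<Rightarrow> real) \<Rightarrow> ereal" where
  "ess_sup_on U f = esssup (lebesgue_on U) (\<lambda>x. ereal (f x))"

definition ess_inf_on :: "'a::euclidean_space set \<Rightarrow> ('a \<Rightarrow> real) \<Rightarrow> ereal" where
  "ess_inf_on U f = - esssup (lebesgue_on U) (\<lambda>x. - ereal (f x))"

end

theory Submission
  imports Defs
begin

text \<open>On the nodal region \<open>V\<close> let \<open>s\<close> be the sign of \<open>e\<close>. If \<open>u\<close> were a solution, then \<open>v = s u \<ge> 0\<close>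
  would satisfy \<open>- \<Delta> v \<ge> \<lambda> v + \<delta>\<close> weakly, where \<open>\<delta> > 0\<close> is the gap between \<open>inf |w|\<close> and the maximum
  of \<open>\<lambda> t - t\<^sup>p\<close>. This inequality is linear, so it survives mollification, and Picone's
  inequality for the test field \<open>\<phi>\<^sup>2 \<nabla> v / (v + \<epsilon>)\<close> gives
  \<open>\<integral> |\<nabla> \<phi>|\<^sup>2 \<ge> \<lambda> \<integral> \<phi>\<^sup>2 + c (\<integral> \<phi>)\<^sup>2\<close> for all test functions \<open>\<phi>\<close> on \<open>V\<close>, with a constant \<open>c > 0\<close>
  depending only on \<open>\<delta>\<close>, \<open>\<lambda>\<close>, the \<open>L\<^sup>1\<close> norm of \<open>u\<close> and the measure of \<open>V\<close>. Letting \<open>\<phi>\<close> tend to \<open>e\<close>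
  contradicts \<open>\<integral> |\<nabla> e|\<^sup>2 = \<lambda> \<integral> e\<^sup>2\<close>. Only the equations in distributional form are used, so
  neither Sobolev embeddings nor the uniqueness of weak gradients are needed.\<close>

section \<open>Calculus of smooth functions\<close>

definition dderiv :: "'a::euclidean_space \<Rightarrow> ('a \<Rightarrow> real) \<Rightarrow> 'a \<Rightarrow> real" where
  "dderiv b f x = frechet_derivative f (at x) b"

lemma dderiv_eqI: "(f has_derivative f') (at x) \<Longrightarrow> dderiv b f x = f' b"
  unfolding dderiv_def by (metis frechet_derivative_at)

lemma grad_eq_dderiv: "grad f x = (\<Sum>b\<in>Basis. dderiv b f x *\<^sub>R b)"
  by (simp add: grad_def dderiv_def)

lemma inner_grad: "b \<in> Basis \<Longrightarrow> grad f x \<bullet> b = dderiv b f x"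
  by (simp add: grad_eq_dderiv)

lemma Ck_on_Suc_dderiv:
  fixes f :: "'a::euclidean_space \<Rightarrow> real"
  shows "Ck_on (Suc k) f UNIV \<longleftrightarrow>
     (\<forall>x. f differentiable (at x)) \<and> (\<forall>v. Ck_on k (dderiv v f) UNIV)"
  by (simp add: dderiv_def[abs_def])

text \<open>\<open>Ck_on (Suc k)\<close> asks for differentiability and says nothing directly about
  continuity of \<open>f\<close>, which is recovered at the base case. The induction runs over all
  \<open>f\<close> because it descends to derivatives.\<close>

lemma Ck_on_SucD: "Ck_on (Suc k) f UNIV \<Longrightarrow> Ck_on k f UNIV"
proof (induction k arbitrary: f)
  case 0
  then show ?case
    by (auto intro!: differentiable_imp_continuous_on simp: differentiable_on_def)
next
  case (Suc k)
  from Suc.prems have d: "\<forall>x. f differentiable (at x)"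
    and "\<forall>v. Ck_on (Suc k) (\<lambda>x. frechet_derivative f (at x) v) UNIV"
    by (simp_all only: Ck_on.simps(2)[of "Suc k"] UNIV_I simp_thms ball_UNIV)
  with Suc.IH show ?case by simp
qed

lemma Ck_on_const: "Ck_on k (\<lambda>_. c) UNIV"
  by (induction k arbitrary: c) auto

lemma Ck_on_add:
  fixes f g :: "'a::euclidean_space \<Rightarrow> real"
  shows "Ck_on k f UNIV \<Longrightarrow> Ck_on k g UNIV \<Longrightarrow> Ck_on k (\<lambda>x. f x + g x) UNIV"
proof (induction k arbitrary: f g)
  case 0
  then show ?case by (auto intro: continuous_on_add)
next
  case (Suc k)
  then have d: "f differentiable (at x)" "g differentiable (at x)" for x
    by (simp_all only: Ck_on_Suc_dderiv)
  have "dderiv v (\<lambda>x. f x + g x) = (\<lambda>x. dderiv v f x + dderiv v g x)" for v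
    using d by (auto simp: fun_eq_iff dderiv_def frechet_derivative_works
        intro!: dderiv_eqI[unfolded dderiv_def] has_derivative_add)
  with Suc d show ?case
    by (simp only: Ck_on_Suc_dderiv differentiable_add) auto
qed

lemma Ck_on_mult:
  fixes f g :: "'a::euclidean_space \<Rightarrow> real"
  shows "Ck_on k f UNIV \<Longrightarrow> Ck_on k g UNIV \<Longrightarrow> Ck_on k (\<lambda>x. f x * g x) UNIV"
proof (induction k arbitrary: f g)
  case 0
  then show ?case by (auto intro: continuous_on_mult)
next
  case (Suc k)
  then have d: "f differentiable (at x)" "g differentiable (at x)" for x
    by (simp_all only: Ck_on_Suc_dderiv)
  have "dderiv v (\<lambda>x. f x * g x) = (\<lambda>x. f x * dderiv v g x + dderiv v f x * g x)" for v
    using d by (auto simp: fun_eq_iff dderiv_def frechet_derivative_works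
        intro!: dderiv_eqI[unfolded dderiv_def] has_derivative_mult)
  \<comment> \<open>The product rule leaves one factor undifferentiated, so the induction also needs
    \<open>f\<close> and \<open>g\<close> themselves at level \<open>k\<close>.\<close>
  moreover have "Ck_on k f UNIV" "Ck_on k g UNIV"
    using Suc.prems by (auto intro: Ck_on_SucD simp del: Ck_on.simps)
  ultimately show ?case
    using Suc d by (simp only: Ck_on_Suc_dderiv differentiable_mult) (auto intro!: Ck_on_add)
qed

lemma dderiv_affine:
  fixes f :: "'a::euclidean_space \<Rightarrow> real"
  assumes "f differentiable (at (a + c *\<^sub>R x))"
  shows "dderiv v (\<lambda>x. f (a + c *\<^sub>R x)) x = c * dderiv v f (a + c *\<^sub>R x)"
proof -
  let ?D = "frechet_derivative f (at (a + c *\<^sub>R x))"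
  have D: "(f has_derivative ?D) (at (a + c *\<^sub>R x))"
    using assms by (simp add: frechet_derivative_works)
  have "((\<lambda>x. f (a + c *\<^sub>R x)) has_derivative (\<lambda>v. ?D (c *\<^sub>R v))) (at x)"
    by (rule has_derivative_compose[where g = f]) (use D in \<open>auto intro!: derivative_eq_intros\<close>)
  moreover have "linear ?D" using D by (rule has_derivative_linear)
  ultimately show ?thesis
    by (subst dderiv_eqI) (auto simp: dderiv_def linear_scale)
qed

lemma differentiable_affine:
  fixes f :: "'a::euclidean_space \<Rightarrow> real"
  assumes "f differentiable (at (a + c *\<^sub>R x))"
  shows "(\<lambda>x. f (a + c *\<^sub>R x)) differentiable (at x)"
  by (rule differentiable_compose[where f = f]) (use assms in auto)

text \<open>Two instances matter: \<open>c = -1\<close> for the reflected kernel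
  \<open>\<eta> (x - y)\<close>, and \<open>a = 0\<close> for rescaling a mollifier.\<close>

lemma Ck_on_affine:
  fixes f :: "'a::euclidean_space \<Rightarrow> real"
  shows "Ck_on k f UNIV \<Longrightarrow> Ck_on k (\<lambda>x. f (a + c *\<^sub>R x)) UNIV"
proof (induction k arbitrary: f)
  case 0
  then show ?case
    by (auto intro!: continuous_on_compose2[of UNIV f] continuous_intros)
next
  case (Suc k)
  then have d: "f differentiable (at x)" for x
    by (simp_all only: Ck_on_Suc_dderiv)
  have "dderiv v (\<lambda>x. f (a + c *\<^sub>R x)) = (\<lambda>x. c * dderiv v f (a + c *\<^sub>R x))" for v
    using d by (auto simp: fun_eq_iff intro: dderiv_affine)
  with Suc d show ?case
    by (simp only: Ck_on_Suc_dderiv differentiable_affine)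
      (auto intro!: Ck_on_mult Ck_on_const)
qed

lemma smooth_on_const: "smooth_on (\<lambda>_. c) UNIV"
  by (simp add: smooth_on_def Ck_on_const)

lemma smooth_on_mult:
  fixes f g :: "'a::euclidean_space \<Rightarrow> real"
  shows "smooth_on f UNIV \<Longrightarrow> smooth_on g UNIV \<Longrightarrow> smooth_on (\<lambda>x. f x * g x) UNIV"
  by (simp add: smooth_on_def Ck_on_mult)

lemma smooth_on_affine:
  fixes f :: "'a::euclidean_space \<Rightarrow> real"
  shows "smooth_on f UNIV \<Longrightarrow> smooth_on (\<lambda>x. f (a + c *\<^sub>R x)) UNIV"
  by (simp add: smooth_on_def Ck_on_affine)

lemma smooth_on_dderiv: "smooth_on f UNIV \<Longrightarrow> smooth_on (dderiv b f) UNIV"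
  unfolding smooth_on_def using Ck_on_Suc_dderiv by blast

lemma smooth_on_differentiable:
  fixes f :: "'a::euclidean_space \<Rightarrow> real"
  shows "smooth_on f UNIV \<Longrightarrow> f differentiable (at x)"
  unfolding smooth_on_def using Ck_on_Suc_dderiv by blast

lemma smooth_on_continuous:
  fixes f :: "'a::euclidean_space \<Rightarrow> real"
  shows "smooth_on f UNIV \<Longrightarrow> continuous_on S f"
  unfolding smooth_on_def using Ck_on.simps(1) continuous_on_subset by blast

lemma smooth_on_borel:
  fixes f :: "'a::euclidean_space \<Rightarrow> real"
  shows "smooth_on f UNIV \<Longrightarrow> f \<in> borel_measurable borel"
  by (intro borel_measurable_continuous_onI smooth_on_continuous)

lemma has_real_derivative_along:
  fixes f :: "'a::euclidean_space \<Rightarrow> real"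
  assumes "smooth_on f UNIV"
  shows "((\<lambda>t. f (x + t *\<^sub>R b)) has_real_derivative dderiv b f (x + t *\<^sub>R b)) (at t)"
proof -
  let ?D = "frechet_derivative f (at (x + t *\<^sub>R b))"
  have D: "(f has_derivative ?D) (at (x + t *\<^sub>R b))"
    using smooth_on_differentiable[OF assms] by (simp add: frechet_derivative_works)
  have "((\<lambda>t. f (x + t *\<^sub>R b)) has_derivative (\<lambda>s. ?D (s *\<^sub>R b))) (at t)"
    by (rule has_derivative_compose[where g = f]) (use D in \<open>auto intro!: derivative_eq_intros\<close>)
  moreover have "(\<lambda>s. ?D (s *\<^sub>R b)) = (*) (dderiv b f (x + t *\<^sub>R b))"
    using has_derivative_linear[OF D] by (auto simp: linear_scale dderiv_def mult.commute)
  ultimately show ?thesis by (simp add: has_field_derivative_def)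
qed

text \<open>The complement of the support is open, so \<open>f\<close> vanishes identically near
  such an \<open>x\<close>; the value \<open>f x = 0\<close> alone would not determine the
  derivative.\<close>

lemma dderiv_eq_0_outside_support:
  assumes "x \<notin> closure {x. f x \<noteq> 0}"
  shows "dderiv b f x = 0"
proof -
  have "(f has_derivative (\<lambda>_. 0)) (at x)"
    by (rule has_derivative_transform_within_open[where f = "\<lambda>_. 0" and s = "- closure {x. f x \<noteq> 0}"])
      (use assms closure_subset[of "{x. f x \<noteq> 0}"] in auto)
  then show ?thesis by (simp add: dderiv_eqI)
qed

section \<open>Test functions\<close>

lemma test_functionsD:
  assumes "\<phi> \<in> test_functions U"
  shows "smooth_on \<phi> UNIV" "compact (closure {x. \<phi> x \<noteq> 0})" "closure {x. \<phi> x \<noteq> 0} \<subseteq> U"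
  using assms by (auto simp: test_functions_def)

lemma test_functions_zero: "\<phi> \<in> test_functions U \<Longrightarrow> x \<notin> U \<Longrightarrow> \<phi> x = 0"
  using closure_subset[of "{x. \<phi> x \<noteq> 0}"] by (auto simp: test_functions_def)

lemma test_functions_mono: "V \<subseteq> U \<Longrightarrow> test_functions V \<subseteq> test_functions U"
  by (auto simp: test_functions_def)

lemma test_functionsI:
  assumes "smooth_on \<phi> UNIV" "compact K" "K \<subseteq> U" "\<And>x. x \<notin> K \<Longrightarrow> \<phi> x = 0"
  shows "\<phi> \<in> test_functions U"
proof -
  have "closure {x. \<phi> x \<noteq> 0} \<subseteq> K"
    using assms(2,4) by (intro closure_minimal) (auto intro: compact_imp_closed)
  then show ?thesis
    using assms compact_Int_closed[of K "closure {x. \<phi> x \<noteq> 0}"]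
    by (auto simp: test_functions_def Int_absorb1)
qed

lemma test_functions_dderiv:
  assumes "\<phi> \<in> test_functions U"
  shows "dderiv b \<phi> \<in> test_functions U"
  using test_functionsD[OF assms]
  by (intro test_functionsI[where K = "closure {x. \<phi> x \<noteq> 0}"])
    (auto intro: smooth_on_dderiv dderiv_eq_0_outside_support)

lemma test_functions_bounded:
  assumes "\<phi> \<in> test_functions U"
  obtains C where "\<And>x. \<bar>\<phi> x\<bar> \<le> C"
proof -
  note t = test_functionsD[OF assms]
  have "compact (\<phi> ` closure {x. \<phi> x \<noteq> 0})"
    by (intro compact_continuous_image t(2) smooth_on_continuous[OF t(1)])
  then obtain C where C: "\<And>x. x \<in> closure {x. \<phi> x \<noteq> 0} \<Longrightarrow> \<bar>\<phi> x\<bar> \<le> C"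
    by (metis (no_types, lifting) bounded_iff compact_imp_bounded image_eqI real_norm_def)
  have "\<bar>\<phi> x\<bar> \<le> max C 0" for x
    using C[of x] closure_subset[of "{x. \<phi> x \<noteq> 0}"] by (cases "\<phi> x = 0") auto
  with that show ?thesis .
qed

lemma test_functions_support_ball:
  assumes "\<phi> \<in> test_functions U"
  obtains R where "R > 0" "\<And>x. R < norm x \<Longrightarrow> \<phi> x = 0"
proof -
  obtain R where "R > 0" "\<And>x. x \<in> closure {x. \<phi> x \<noteq> 0} \<Longrightarrow> norm x \<le> R"
    using compact_imp_bounded[OF test_functionsD(2)[OF assms]] by (meson bounded_pos)
  then show ?thesis
    using closure_subset[of "{x. \<phi> x \<noteq> 0}"] by (intro that[of R]) (auto, force)
qed

text \<open>The support is a compact subset of \<open>U\<close> and \<open>\<phi>\<close> is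
  bounded, so a multiple of \<open>f\<close> cut off to the support dominates the product.\<close>

lemma test_functions_integrable_mult:
  assumes "\<phi> \<in> test_functions U" "locally_integrable U f"
  shows "integrable lebesgue (\<lambda>x. \<phi> x *\<^sub>R f x)"
proof -
  let ?K = "closure {x. \<phi> x \<noteq> 0}"
  note t = test_functionsD[OF assms(1)]
  obtain C where C: "\<And>x. \<bar>\<phi> x\<bar> \<le> C" using test_functions_bounded[OF assms(1)] by blast
  have "set_integrable lebesgue ?K f" using assms(2) t by (auto simp: locally_integrable_def)
  then have i: "integrable lebesgue (\<lambda>x. indicator ?K x *\<^sub>R f x)"
    by (simp add: set_integrable_def)
  have "\<phi> \<in> borel_measurable lebesgue"
    using smooth_on_borel[OF t(1)] by (simp add: measurable_completion)
  have e: "\<phi> x *\<^sub>R f x = \<phi> x *\<^sub>R (indicator ?K x *\<^sub>R f x)" for x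
    using closure_subset[of "{x. \<phi> x \<noteq> 0}"] by (cases "\<phi> x = 0") (auto simp: indicator_def)
  have "integrable lebesgue (\<lambda>x. \<phi> x *\<^sub>R (indicator ?K x *\<^sub>R f x))"
  proof (rule Bochner_Integration.integrable_bound)
    show "integrable lebesgue (\<lambda>x. C *\<^sub>R norm (indicator ?K x *\<^sub>R f x))"
      using i by (intro integrable_scaleR_right integrable_norm)
    show "(\<lambda>x. \<phi> x *\<^sub>R indicator ?K x *\<^sub>R f x) \<in> borel_measurable lebesgue"
      using borel_measurable_integrable[OF i] \<open>\<phi> \<in> borel_measurable lebesgue\<close>
      by (rule borel_measurable_scaleR[rotated])
    have "C \<ge> 0" using C[of 0] by linarith
    with C show "AE x in lebesgue. norm (\<phi> x *\<^sub>R indicator ?K x *\<^sub>R f x) \<le>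
        norm (C *\<^sub>R norm (indicator ?K x *\<^sub>R f x))"
      by (auto intro!: always_eventually mult_mono simp: abs_mult mult.assoc)
  qed
  then show ?thesis by (subst e)
qed

lemma test_functions_integrable:
  assumes "\<phi> \<in> test_functions U"
  shows "integrable lborel \<phi>"
proof -
  note t = test_functionsD[OF assms]
  have "set_integrable lborel (closure {x. \<phi> x \<noteq> 0}) \<phi>"
    unfolding set_integrable_def
    by (intro borel_integrable_compact t(2) smooth_on_continuous[OF t(1)])
  moreover have "indicator (closure {x. \<phi> x \<noteq> 0}) x *\<^sub>R \<phi> x = \<phi> x" for x
    using closure_subset[of "{x. \<phi> x \<noteq> 0}"] by (cases "\<phi> x = 0") (auto simp: indicator_def)
  ultimately show ?thesis unfolding set_integrable_def by (simp only:)
qed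

lemma test_functions_mult:
  assumes "\<phi> \<in> test_functions U" "smooth_on \<psi> UNIV"
  shows "(\<lambda>x. \<phi> x * \<psi> x) \<in> test_functions U"
  using test_functionsD[OF assms(1)] closure_subset[of "{x. \<phi> x \<noteq> 0}"]
  by (intro test_functionsI[where K = "closure {x. \<phi> x \<noteq> 0}"] smooth_on_mult assms(2)) auto

section \<open>Directional derivatives and integrals\<close>

text \<open>By the mean value inequality \<open>B\<close> dominates the difference quotients, so
  dominated convergence applies along every sequence tending to 0.\<close>

lemma has_real_derivative_integral:
  fixes F F' :: "real \<Rightarrow> 'a \<Rightarrow> real"
  assumes int: "\<And>t. integrable M (F t)"
    and meas: "F' 0 \<in> borel_measurable M"
    and deriv: "\<And>t y. ((\<lambda>t. F t y) has_real_derivative F' t y) (at t)"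
    and bound: "\<And>t y. \<bar>t\<bar> < 1 \<Longrightarrow> \<bar>F' t y\<bar> \<le> B y"
    and B: "integrable M B"
  shows "((\<lambda>t. \<integral>y. F t y \<partial>M) has_real_derivative (\<integral>y. F' 0 y \<partial>M)) (at 0)"
  unfolding has_field_derivative_iff tendsto_at_iff_sequentially
proof (intro allI impI)
  fix X :: "nat \<Rightarrow> real"
  assume X0: "\<forall>i. X i \<in> UNIV - {0}" and X: "X \<longlonglongrightarrow> 0"
  \<comment> \<open>The bound on the derivative is available for \<open>\<bar>t\<bar> < 1\<close>;
    dropping the first \<open>N\<close> terms puts the whole sequence there.\<close>
  obtain N where N: "\<And>n. n \<ge> N \<Longrightarrow> \<bar>X n\<bar> < 1"
    using LIMSEQ_D[OF X, of 1] by auto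
  define q where "q n y = (F (X (n + N)) y - F 0 y) / X (n + N)" for n y
  have "(\<lambda>n. \<integral>y. q n y \<partial>M) \<longlonglongrightarrow> (\<integral>y. F' 0 y \<partial>M)"
  proof (rule integral_dominated_convergence[where w = B])
    show "F' 0 \<in> borel_measurable M" by fact
    show "q n \<in> borel_measurable M" for n
      using int unfolding q_def[abs_def] by measurable
    show "integrable M B" by fact
    show "AE y in M. (\<lambda>n. q n y) \<longlonglongrightarrow> F' 0 y"
    proof (intro always_eventually allI)
      fix y
      have "((\<lambda>t. (F t y - F 0 y) / (t - 0)) \<longlongrightarrow> F' 0 y) (at 0)"
        using deriv[of y 0] by (simp add: has_field_derivative_iff)
      moreover have "(\<lambda>n. X (n + N)) \<longlonglongrightarrow> 0"
        using X by (rule LIMSEQ_ignore_initial_segment)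
      ultimately show "(\<lambda>n. q n y) \<longlonglongrightarrow> F' 0 y"
        unfolding tendsto_at_iff_sequentially q_def using X0 by (auto simp: comp_def)
    qed
    show "AE y in M. norm (q n y) \<le> B y" for n
    proof (intro always_eventually allI)
      fix y
      have "norm (F (X (n + N)) y - F 0 y) \<le> B y * norm (X (n + N) - 0)"
      proof (rule field_differentiable_bound[where S = "{-1<..<1}" and f' = "\<lambda>t. F' t y"])
        show "((\<lambda>t. F t y) has_field_derivative F' z y) (at z within {-1<..<1})" for z
          using deriv by (rule DERIV_subset) simp
        show "norm (F' z y) \<le> B y" if "z \<in> {-1<..<1}" for z
          using bound[of z y] that by auto
        show "X (n + N) \<in> {-1<..<1}" using N[of "n + N"] by auto
      qed auto
      then show "norm (q n y) \<le> B y"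
        using X0 by (auto simp: q_def norm_divide divide_le_eq)
    qed
  qed
  moreover have "(\<integral>y. q n y \<partial>M) = ((\<integral>y. F (X (n + N)) y \<partial>M) - (\<integral>y. F 0 y \<partial>M)) / X (n + N)" for n
    using int by (simp add: q_def)
  ultimately have "(\<lambda>n. ((\<integral>y. F (X (n + N)) y \<partial>M) - (\<integral>y. F 0 y \<partial>M)) / X (n + N))
      \<longlonglongrightarrow> (\<integral>y. F' 0 y \<partial>M)" by simp
  then show "((\<lambda>t. ((\<integral>y. F t y \<partial>M) - (\<integral>y. F 0 y \<partial>M)) / (t - 0)) \<circ> X) \<longlonglongrightarrow> (\<integral>y. F' 0 y \<partial>M)"
    unfolding comp_def diff_zero
    by (rule LIMSEQ_offset[where k = N and
        f = "\<lambda>n. ((\<integral>y. F (X n) y \<partial>M) - (\<integral>y. F 0 y \<partial>M)) / X n"])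
qed

text \<open>Differentiability along lines in the single direction \<open>b\<close>, with the
  derivative named as a function. This is the form that integration by parts uses, and it is easily
  established for convolutions and quotients.\<close>

definition has_dderiv :: "'a::euclidean_space \<Rightarrow> ('a \<Rightarrow> real) \<Rightarrow> ('a \<Rightarrow> real) \<Rightarrow> bool" where
  "has_dderiv b f f' \<longleftrightarrow>
     (\<forall>x t. ((\<lambda>t. f (x + t *\<^sub>R b)) has_real_derivative f' (x + t *\<^sub>R b)) (at t))"

text \<open>The derivative at \<open>t\<close> along the line through \<open>x\<close> is the
  derivative at 0 along the line through \<open>x + t *\<^sub>R b\<close>.\<close>

lemma has_dderivI:
  assumes "\<And>x. ((\<lambda>t. f (x + t *\<^sub>R b)) has_real_derivative f' x) (at 0)"
  shows "has_dderiv b f f'"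
  unfolding has_dderiv_def
proof (intro allI)
  fix x t
  have "((\<lambda>s. f ((x + t *\<^sub>R b) + s *\<^sub>R b)) has_real_derivative f' (x + t *\<^sub>R b)) (at 0)"
    by (rule assms)
  then show "((\<lambda>t. f (x + t *\<^sub>R b)) has_real_derivative f' (x + t *\<^sub>R b)) (at t)"
    using DERIV_shift[of "\<lambda>t. f (x + t *\<^sub>R b)" "f' (x + t *\<^sub>R b)" 0 t]
    by (simp add: algebra_simps)
qed

lemma has_dderiv_at:
  "has_dderiv b f f' \<Longrightarrow> ((\<lambda>t. f (x + t *\<^sub>R b)) has_real_derivative f' (x + t *\<^sub>R b)) (at t)"
  by (simp add: has_dderiv_def)

lemma smooth_has_dderiv: "smooth_on f UNIV \<Longrightarrow> has_dderiv b f (dderiv b f)"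
  by (simp add: has_dderiv_def has_real_derivative_along)

lemma
  fixes f :: "'a::euclidean_space \<Rightarrow> real"
  assumes "integrable lborel f"
  shows integrable_translate: "integrable lborel (\<lambda>x. f (x + c))"
    and integral_translate: "(\<integral>x. f (x + c) \<partial>lborel) = (\<integral>x. f x \<partial>lborel)"
proof -
  have [measurable]: "f \<in> borel_measurable borel" using assms by auto
  have d: "distr lborel borel ((+) c) = lborel" by (rule lborel_distr_plus)
  show "integrable lborel (\<lambda>x. f (x + c))"
    using assms integrable_distr_eq[of "(+) c" lborel borel f] d by (simp add: add.commute)
  show "(\<integral>x. f (x + c) \<partial>lborel) = (\<integral>x. f x \<partial>lborel)"
    using integral_distr[of "(+) c" lborel borel f] d by (simp add: add.commute)
qed

text \<open>The integral of \<open>x \<mapsto> f (x + t b)\<close> does not depend on \<open>t\<close>.\<close>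

lemma integral_dderiv_eq_0:
  fixes f f' :: "'a::euclidean_space \<Rightarrow> real"
  assumes f: "integrable lborel f" and d: "has_dderiv b f f'"
    and m [measurable]: "f' \<in> borel_measurable borel"
    and C: "\<And>x. \<bar>f' x\<bar> \<le> C" and R: "\<And>x. R < norm x \<Longrightarrow> f' x = 0"
  shows "(\<integral>x. f' x \<partial>lborel) = 0"
proof -
  \<comment> \<open>For \<open>\<bar>t\<bar> < 1\<close> the shift by \<open>t *\<^sub>R b\<close>
    moves points by at most \<open>norm b\<close>, so outside this ball all shifted derivatives
    vanish.\<close>
  let ?B = "\<lambda>x. C * indicator (cball (0::'a) (R + norm b)) x"
  have "((\<lambda>t. \<integral>x. f (x + t *\<^sub>R b) \<partial>lborel) has_real_derivative
      (\<integral>x. f' (x + 0 *\<^sub>R b) \<partial>lborel)) (at 0)"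
  proof (rule has_real_derivative_integral[where B = ?B])
    show "\<bar>f' (x + t *\<^sub>R b)\<bar> \<le> ?B x" if "\<bar>t\<bar> < 1" for x t
    proof (cases "norm x \<le> R + norm b")
      case True
      then show ?thesis using C by simp
    next
      case False
      have "norm (t *\<^sub>R b) \<le> norm b" using that by (auto simp: mult_left_le_one_le)
      moreover have "norm x \<le> norm (x + t *\<^sub>R b) + norm (t *\<^sub>R b)"
        by (metis add_diff_cancel norm_triangle_ineq4)
      ultimately have "R < norm (x + t *\<^sub>R b)" using False by linarith
      then show ?thesis using R C[of 0] False by simp
    qed
    show "integrable lborel ?B"
      by (intro integrable_mult_right integrable_real_indicator) (auto simp: emeasure_lborel_cball_finite[unfolded infinity_ennreal_def])
    show "integrable lborel (\<lambda>x. f (x + t *\<^sub>R b))" for t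
      by (rule integrable_translate[OF f])
    show "(\<lambda>x. f' (x + 0 *\<^sub>R b)) \<in> borel_measurable lborel" by simp
    show "((\<lambda>t. f (x + t *\<^sub>R b)) has_real_derivative f' (x + t *\<^sub>R b)) (at t)" for t x
      by (rule has_dderiv_at[OF d])
  qed
  moreover have "((\<lambda>t. \<integral>x. f (x + t *\<^sub>R b) \<partial>lborel) has_real_derivative 0) (at 0)"
    by (simp add: integral_translate[OF f])
  ultimately show ?thesis
    by (auto dest: DERIV_unique)
qed

section \<open>Convolution and its derivatives\<close>

definition conv :: "('a::euclidean_space \<Rightarrow> real) \<Rightarrow> ('a \<Rightarrow> real) \<Rightarrow> 'a \<Rightarrow> real" where
  "conv U \<eta> x = (\<integral>y. U y * \<eta> (x - y) \<partial>lborel)"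

lemma conv_measurable:
  fixes U \<eta> :: "'a::euclidean_space \<Rightarrow> real"
  assumes [measurable]: "U \<in> borel_measurable borel" "\<eta> \<in> borel_measurable borel"
  shows "conv U \<eta> \<in> borel_measurable borel"
  unfolding conv_def by measurable

lemma integrable_mult_bounded:
  fixes f g :: "'a \<Rightarrow> real"
  assumes f: "integrable M f" and g: "g \<in> borel_measurable M" and C: "\<And>x. \<bar>g x\<bar> \<le> C"
  shows "integrable M (\<lambda>x. f x * g x)"
proof (rule Bochner_Integration.integrable_bound)
  show "integrable M (\<lambda>x. norm (f x) * C)" using f by auto
  show "(\<lambda>x. f x * g x) \<in> borel_measurable M" using f g by measurable
  have "\<bar>g x\<bar> \<le> \<bar>C\<bar>" for x using C[of x] by linarith
  then show "AE x in M. norm (f x * g x) \<le> norm (norm (f x) * C)"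
    by (auto simp: abs_mult intro!: mult_left_mono)
qed

lemma integrable_conv_kernel:
  fixes U \<eta> :: "'a::euclidean_space \<Rightarrow> real"
  assumes U: "integrable lborel U" and [measurable]: "\<eta> \<in> borel_measurable borel"
    and C: "\<And>x. \<bar>\<eta> x\<bar> \<le> C"
  shows "integrable lborel (\<lambda>y. U y * \<eta> (x - y))"
  using assms by (intro integrable_mult_bounded[OF U _ C]) measurable

lemma conv_bounded:
  fixes U \<eta> :: "'a::euclidean_space \<Rightarrow> real"
  assumes U: "integrable lborel U" and m: "\<eta> \<in> borel_measurable borel"
    and C: "\<And>x. \<bar>\<eta> x\<bar> \<le> C"
  shows "\<bar>conv U \<eta> x\<bar> \<le> C * (\<integral>y. \<bar>U y\<bar> \<partial>lborel)"
proof -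
  have "\<bar>conv U \<eta> x\<bar> \<le> (\<integral>y. \<bar>U y * \<eta> (x - y)\<bar> \<partial>lborel)"
    unfolding conv_def by (rule integral_abs_bound)
  also have "\<dots> \<le> (\<integral>y. C * \<bar>U y\<bar> \<partial>lborel)"
    using U integrable_conv_kernel[OF U m C]
    by (intro integral_mono integrable_abs)
      (auto simp: abs_mult mult.commute[of C] intro!: mult_left_mono C)
  finally show ?thesis by simp
qed

text \<open>The derivative falls on the kernel, which is how a merely integrable \<open>U\<close>
  becomes differentiable; \<open>C' * \<bar>U y\<bar>\<close> is the dominating function.\<close>

lemma has_dderiv_conv:
  fixes U \<eta> :: "'a::euclidean_space \<Rightarrow> real"
  assumes U: "integrable lborel U" and d: "has_dderiv b \<eta> \<eta>'"
    and m [measurable]: "\<eta> \<in> borel_measurable borel" "\<eta>' \<in> borel_measurable borel"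
    and C: "\<And>x. \<bar>\<eta> x\<bar> \<le> C" and C': "\<And>x. \<bar>\<eta>' x\<bar> \<le> C'"
  shows "has_dderiv b (conv U \<eta>) (conv U \<eta>')"
proof (rule has_dderivI)
  fix x
  have "((\<lambda>t. \<integral>y. U y * \<eta> (x + t *\<^sub>R b - y) \<partial>lborel) has_real_derivative
      (\<integral>y. U y * \<eta>' (x + 0 *\<^sub>R b - y) \<partial>lborel)) (at 0)"
  proof (rule has_real_derivative_integral[where B = "\<lambda>y. C' * \<bar>U y\<bar>"])
    show "integrable lborel (\<lambda>y. U y * \<eta> (x + t *\<^sub>R b - y))" for t
      by (rule integrable_conv_kernel[OF U m(1) C])
    show "(\<lambda>y. U y * \<eta>' (x + 0 *\<^sub>R b - y)) \<in> borel_measurable lborel"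
      using U by measurable
    show "\<bar>U y * \<eta>' (x + t *\<^sub>R b - y)\<bar> \<le> C' * \<bar>U y\<bar>" for t y
      using mult_right_mono[OF C'[of "x + t *\<^sub>R b - y"] abs_ge_zero[of "U y"]]
      by (simp add: abs_mult mult.commute)
    show "integrable lborel (\<lambda>y. C' * \<bar>U y\<bar>)" using U by auto
    show "((\<lambda>t. U y * \<eta> (x + t *\<^sub>R b - y)) has_real_derivative U y * \<eta>' (x + t *\<^sub>R b - y)) (at t)"
      for t y
      using DERIV_cmult[OF has_dderiv_at[OF d, of "x - y" t], of "U y"]
      by (simp add: algebra_simps)
  qed
  then show "((\<lambda>t. conv U \<eta> (x + t *\<^sub>R b)) has_real_derivative conv U \<eta>' x) (at 0)"
    by (simp add: conv_def)
qed

text \<open>Fubini's theorem: for fixed \<open>y\<close>, the inner integral of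
  \<open>\<eta> (x - y)\<close> over \<open>x\<close> does not depend on \<open>y\<close>.\<close>

lemma
  fixes U \<eta> :: "'a::euclidean_space \<Rightarrow> real"
  assumes U: "integrable lborel U" and \<eta>: "integrable lborel \<eta>"
  shows integrable_conv: "integrable lborel (conv U \<eta>)"
    and integral_conv: "(\<integral>x. conv U \<eta> x \<partial>lborel) = (\<integral>y. U y \<partial>lborel) * (\<integral>x. \<eta> x \<partial>lborel)"
proof -
  have [measurable]: "U \<in> borel_measurable borel" "\<eta> \<in> borel_measurable borel"
    using U \<eta> by auto
  let ?f = "\<lambda>(y, x). U y * \<eta> (x - y)"
  have tr: "(\<integral>x. g (x - y) \<partial>lborel) = (\<integral>x. g x \<partial>lborel)"
    "integrable lborel (\<lambda>x. g (x - y))" if "integrable lborel g" for g :: "'a \<Rightarrow> real" and y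
    using integral_translate[OF that, of "- y"] integrable_translate[OF that, of "- y"] by simp_all
  have "integrable (lborel \<Otimes>\<^sub>M lborel) ?f"
  proof (rule lborel_pair.Fubini_integrable)
    show "?f \<in> borel_measurable (lborel \<Otimes>\<^sub>M lborel)" by measurable
    have "(\<integral>x. norm (?f (y, x)) \<partial>lborel) = \<bar>U y\<bar> * (\<integral>x. \<bar>\<eta> x\<bar> \<partial>lborel)" for y
      using tr(1)[of "\<lambda>x. \<bar>\<eta> x\<bar>" y] \<eta> by (simp add: abs_mult)
    then show "integrable lborel (\<lambda>y. \<integral>x. norm (?f (y, x)) \<partial>lborel)"
      using U by simp
    show "AE y in lborel. integrable lborel (\<lambda>x. ?f (y, x))"
      using tr(2)[OF \<eta>] by simp
  qed
  then have i: "integrable (lborel \<Otimes>\<^sub>M lborel) (\<lambda>(y, x). U y * \<eta> (x - y))" .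
  from lborel_pair.integrable_snd[OF i] show "integrable lborel (conv U \<eta>)"
    by (simp add: conv_def[abs_def])
  show "(\<integral>x. conv U \<eta> x \<partial>lborel) = (\<integral>y. U y \<partial>lborel) * (\<integral>x. \<eta> x \<partial>lborel)"
    using lborel_pair.Fubini_integral[OF i] by (simp add: conv_def tr(1)[OF \<eta>])
qed

section \<open>Picone's inequality\<close>

text \<open>The function differentiated is the component in direction \<open>b\<close> of the field
  \<open>\<phi>^2 grad v / (v + \<epsilon>)\<close>, whose divergence yields Picone's
  inequality.\<close>

lemma has_dderiv_picone_field:
  assumes \<phi>: "has_dderiv b \<phi> \<phi>'" and v: "has_dderiv b v v'" and v': "has_dderiv b v' v''"
    and pos: "\<And>x. 0 < v x + \<epsilon>"
  shows "has_dderiv b (\<lambda>x. v' x / (v x + \<epsilon>) * (\<phi> x)\<^sup>2)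
    (\<lambda>x. v'' x / (v x + \<epsilon>) * (\<phi> x)\<^sup>2 + 2 * (v' x / (v x + \<epsilon>)) * (\<phi> x * \<phi>' x)
        - (v' x / (v x + \<epsilon>))\<^sup>2 * (\<phi> x)\<^sup>2)"
  unfolding has_dderiv_def
proof (intro allI)
  fix x t
  \<comment> \<open>Brings the output of the derivative rules into a sum of separately integrable
    terms; \<open>w\<close>, \<open>q\<close>, \<open>s\<close>, \<open>p\<close>, \<open>d\<close>
    stand for \<open>v + \<epsilon>\<close>, \<open>v'\<close>, \<open>v''\<close>,
    \<open>\<phi>\<close>, \<open>\<phi>'\<close>.\<close>
  have quotient: "w \<noteq> 0 \<Longrightarrow> (s * w - q * q) / (w * w) * p\<^sup>2 + 2 * (d * p) * (q / w)
      = s / w * p\<^sup>2 + 2 * (q / w) * (p * d) - (q / w)\<^sup>2 * p\<^sup>2"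
    for p q s d w :: real
    by (simp add: field_simps power2_eq_square)
  have "v (x + t *\<^sub>R b) + \<epsilon> \<noteq> 0" using pos[of "x + t *\<^sub>R b"] by simp
  then show "((\<lambda>t. v' (x + t *\<^sub>R b) / (v (x + t *\<^sub>R b) + \<epsilon>) * (\<phi> (x + t *\<^sub>R b))\<^sup>2) has_real_derivative
      v'' (x + t *\<^sub>R b) / (v (x + t *\<^sub>R b) + \<epsilon>) * (\<phi> (x + t *\<^sub>R b))\<^sup>2
      + 2 * (v' (x + t *\<^sub>R b) / (v (x + t *\<^sub>R b) + \<epsilon>)) * (\<phi> (x + t *\<^sub>R b) * \<phi>' (x + t *\<^sub>R b))
      - (v' (x + t *\<^sub>R b) / (v (x + t *\<^sub>R b) + \<epsilon>))\<^sup>2 * (\<phi> (x + t *\<^sub>R b))\<^sup>2) (at t)"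
    by (intro DERIV_cong[OF DERIV_mult[OF DERIV_divide[OF has_dderiv_at[OF v']
          DERIV_add[OF has_dderiv_at[OF v] DERIV_const[of \<epsilon>]]] DERIV_power[OF has_dderiv_at[OF \<phi>], where n = 2]]])
      (simp_all add: quotient del: times_divide_eq_right times_divide_eq_left)
qed

lemma integrable_bounded_mult_test:
  fixes q :: "'a::euclidean_space \<Rightarrow> real"
  assumes \<phi>: "\<phi> \<in> test_functions V" and q: "q \<in> borel_measurable borel" "\<And>x. \<bar>q x\<bar> \<le> C"
  shows "integrable lborel (\<lambda>x. q x * \<phi> x)"
  using integrable_mult_bounded[OF test_functions_integrable[OF \<phi>] _ q(2)] q(1)
  by (simp add: mult.commute)

text \<open>The divergence of the Picone field integrates to 0, while completing the square bounds
  it pointwise by the squared gradient of \<open>\<phi>\<close> plus the Laplacian of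
  \<open>v\<close> times \<open>\<phi>^2 / (v + \<epsilon>)\<close>. The inequality
  \<open>super\<close> is asked only where \<open>\<phi>\<close> is nonzero, since a mollification
  inherits it only away from the boundary.\<close>

lemma integral_picone:
  fixes \<phi> v :: "'a::euclidean_space \<Rightarrow> real" and v' v'' :: "'a \<Rightarrow> 'a \<Rightarrow> real"
  assumes \<phi>: "\<phi> \<in> test_functions V"
    and v: "\<And>x. 0 \<le> v x" "v \<in> borel_measurable borel"
    and v': "\<And>b. b \<in> Basis \<Longrightarrow> has_dderiv b v (v' b)" "\<And>b. b \<in> Basis \<Longrightarrow> v' b \<in> borel_measurable borel"
      "\<And>b. b \<in> Basis \<Longrightarrow> \<exists>C. \<forall>x. \<bar>v' b x\<bar> \<le> C"
    and v'': "\<And>b. b \<in> Basis \<Longrightarrow> has_dderiv b (v' b) (v'' b)" "\<And>b. b \<in> Basis \<Longrightarrow> v'' b \<in> borel_measurable borel"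
      "\<And>b. b \<in> Basis \<Longrightarrow> \<exists>C. \<forall>x. \<bar>v'' b x\<bar> \<le> C"
    and super: "\<And>x. \<phi> x \<noteq> 0 \<Longrightarrow> lam * v x + \<delta> \<le> - (\<Sum>b\<in>Basis. v'' b x)"
    and \<epsilon>: "0 < \<epsilon>" "lam * \<epsilon> \<le> \<delta> / 2"
  shows "lam * (\<integral>x. (\<phi> x)\<^sup>2 \<partial>lborel) + \<delta> / 2 * (\<integral>x. (\<phi> x)\<^sup>2 / (v x + \<epsilon>) \<partial>lborel)
    \<le> (\<integral>x. (\<Sum>b\<in>Basis. (dderiv b \<phi> x)\<^sup>2) \<partial>lborel)"
proof -
  have pos: "0 < v x + \<epsilon>" for x using v(1)[of x] \<epsilon>(1) by linarith
  note [measurable] = v(2)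
  \<comment> \<open>The contribution of direction \<open>b\<close> to the divergence of the Picone
    field, so its integral vanishes.\<close>
  define X' where "X' b x = v'' b x / (v x + \<epsilon>) * (\<phi> x)\<^sup>2 + 2 * (v' b x / (v x + \<epsilon>)) * (\<phi> x * dderiv b \<phi> x)
        - (v' b x / (v x + \<epsilon>))\<^sup>2 * (\<phi> x)\<^sup>2" for b x
  have sm: "smooth_on \<phi> UNIV" "smooth_on (dderiv b \<phi>) UNIV" for b
    using test_functionsD(1)[OF \<phi>] smooth_on_dderiv by blast+
  have t2: "(\<lambda>x. (\<phi> x)\<^sup>2) \<in> test_functions V" "(\<lambda>x. \<phi> x * dderiv b \<phi> x) \<in> test_functions V"
    "(\<lambda>x. (dderiv b \<phi> x)\<^sup>2) \<in> test_functions V" for b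
    unfolding power2_eq_square using \<phi> sm
    by (auto intro: test_functions_mult test_functions_dderiv)
  \<comment> \<open>Since \<open>v\<close> is nonnegative the denominator is at least
    \<open>\<epsilon>\<close>, which is the reason for adding it.\<close>
  have bound: "\<bar>q x / (v x + \<epsilon>)\<bar> \<le> C / \<epsilon>" if "\<And>x. \<bar>q x\<bar> \<le> C" for q x C
    using that[of x] v(1)[of x] \<epsilon>(1) by (auto intro!: frac_le order_trans[OF abs_ge_zero])
  have X': "integrable lborel (X' b)" "(\<integral>x. X' b x \<partial>lborel) = 0" if b: "b \<in> Basis" for b
  proof -
    note [measurable] = v'(2)[OF b] v''(2)[OF b]
    obtain C1 where C1: "\<And>x. \<bar>v' b x\<bar> \<le> C1" using v'(3)[OF b] by blast
    obtain C2 where C2: "\<And>x. \<bar>v'' b x\<bar> \<le> C2" using v''(3)[OF b] by blast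
    have C1sq: "\<bar>(v' b x / (v x + \<epsilon>))\<^sup>2\<bar> \<le> (C1 / \<epsilon>)\<^sup>2" for x
      using power_mono[OF bound[of "v' b", OF C1, of x] abs_ge_zero, of 2]
      by (simp only: power2_abs abs_power2)
    have C1d: "\<bar>2 * (v' b x / (v x + \<epsilon>))\<bar> \<le> 2 * (C1 / \<epsilon>)" for x
      using bound[of "v' b", OF C1, of x] by simp
    show i: "integrable lborel (X' b)"
      unfolding X'_def[abs_def]
      by (intro Bochner_Integration.integrable_add Bochner_Integration.integrable_diff
        integrable_bounded_mult_test[OF t2(1)] integrable_bounded_mult_test[OF t2(2)])
        (measurable, rule bound, rule C2, measurable, rule C1d, measurable, rule C1sq)
    obtain A where A: "\<And>x. \<bar>(\<phi> x)\<^sup>2\<bar> \<le> A" using test_functions_bounded[OF t2(1)] by blast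
    obtain B where B: "\<And>x. \<bar>\<phi> x * dderiv b \<phi> x\<bar> \<le> B" using test_functions_bounded[OF t2(2)] by blast
    obtain R where R: "\<And>x. R < norm x \<Longrightarrow> \<phi> x = 0" using test_functions_support_ball[OF \<phi>] by blast
    show "(\<integral>x. X' b x \<partial>lborel) = 0"
    proof (rule integral_dderiv_eq_0)
      show "integrable lborel (\<lambda>x. v' b x / (v x + \<epsilon>) * (\<phi> x)\<^sup>2)"
        by (rule integrable_bounded_mult_test[OF t2(1) _ bound[OF C1]]) measurable
      show "has_dderiv b (\<lambda>x. v' b x / (v x + \<epsilon>) * (\<phi> x)\<^sup>2) (X' b)"
        unfolding X'_def
        by (rule has_dderiv_picone_field[OF smooth_has_dderiv[OF sm(1)] v'(1)[OF b] v''(1)[OF b] pos])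
      show "X' b \<in> borel_measurable borel" using i by auto
      show "\<bar>X' b x\<bar> \<le> (C2 / \<epsilon>) * A + 2 * (C1 / \<epsilon>) * B + (C1 / \<epsilon>)\<^sup>2 * A" for x
      proof -
        have "\<bar>v'' b x / (v x + \<epsilon>) * (\<phi> x)\<^sup>2\<bar> \<le> (C2 / \<epsilon>) * A"
          unfolding abs_mult using order_trans[OF abs_ge_zero bound[OF C2]]
          by (intro mult_mono bound[OF C2] A) auto
        moreover have "\<bar>2 * (v' b x / (v x + \<epsilon>)) * (\<phi> x * dderiv b \<phi> x)\<bar> \<le> 2 * (C1 / \<epsilon>) * B"
          unfolding abs_mult[of "2 * (v' b x / (v x + \<epsilon>))"] using order_trans[OF abs_ge_zero C1d]
          by (intro mult_mono C1d B) auto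
        moreover have "\<bar>(v' b x / (v x + \<epsilon>))\<^sup>2 * (\<phi> x)\<^sup>2\<bar> \<le> (C1 / \<epsilon>)\<^sup>2 * A"
          unfolding abs_mult by (intro mult_mono C1sq A) auto
        ultimately show ?thesis unfolding X'_def by linarith
      qed
      show "X' b x = 0" if "R < norm x" for x using R[OF that] by (simp add: X'_def)
    qed
  qed
  have pw: "(\<Sum>b\<in>Basis. X' b x) + lam * (\<phi> x)\<^sup>2 + \<delta> / 2 * ((\<phi> x)\<^sup>2 / (v x + \<epsilon>))
      \<le> (\<Sum>b\<in>Basis. (dderiv b \<phi> x)\<^sup>2)" for x
  proof -
    have "X' b x \<le> (dderiv b \<phi> x)\<^sup>2 + v'' b x * ((\<phi> x)\<^sup>2 / (v x + \<epsilon>))" for b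
    proof -
      \<comment> \<open>Expanding this square bounds the mixed term minus the squared quotient in
        \<open>X'\<close> by \<open>(dderiv b \<phi> x)\<^sup>2\<close>.\<close>
      have "0 \<le> (dderiv b \<phi> x - v' b x / (v x + \<epsilon>) * \<phi> x)\<^sup>2" by simp
      then show ?thesis unfolding X'_def by (simp add: power2_eq_square algebra_simps)
    qed
    then have "(\<Sum>b\<in>Basis. X' b x) \<le>
        (\<Sum>b\<in>Basis. (dderiv b \<phi> x)\<^sup>2 + v'' b x * ((\<phi> x)\<^sup>2 / (v x + \<epsilon>)))"
      by (intro sum_mono)
    also have "\<dots> = (\<Sum>b\<in>Basis. (dderiv b \<phi> x)\<^sup>2) + (\<Sum>b\<in>Basis. v'' b x) * ((\<phi> x)\<^sup>2 / (v x + \<epsilon>))"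
      by (simp only: sum.distrib sum_distrib_right)
    finally have 1: "(\<Sum>b\<in>Basis. X' b x) \<le> \<dots>" .
    \<comment> \<open>Half of \<open>\<delta>\<close> pays for replacing \<open>v x\<close> by
      \<open>v x + \<epsilon>\<close>, so that the denominator cancels in the term with
      \<open>lam\<close>.\<close>
    have super': "lam * (v x + \<epsilon>) + \<delta> / 2 \<le> - (\<Sum>b\<in>Basis. v'' b x)" if "\<phi> x \<noteq> 0"
      using super[OF that] \<epsilon>(2) by (simp add: algebra_simps)
    have "(lam * (v x + \<epsilon>) + \<delta> / 2) * ((\<phi> x)\<^sup>2 / (v x + \<epsilon>))
        \<le> - (\<Sum>b\<in>Basis. v'' b x) * ((\<phi> x)\<^sup>2 / (v x + \<epsilon>))"
    proof (cases "\<phi> x = 0")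
      case False
      with super' show ?thesis using pos[of x] by (intro mult_right_mono) auto
    qed simp
    moreover have "(lam * (v x + \<epsilon>) + \<delta> / 2) * ((\<phi> x)\<^sup>2 / (v x + \<epsilon>))
        = lam * (\<phi> x)\<^sup>2 + \<delta> / 2 * ((\<phi> x)\<^sup>2 / (v x + \<epsilon>))"
      using pos[of x] by (simp add: field_simps)
    ultimately show ?thesis using 1 by linarith
  qed
  have i1: "integrable lborel (\<lambda>x. (\<phi> x)\<^sup>2)"
    by (rule test_functions_integrable[OF t2(1)])
  have "(\<lambda>x. 1 / (v x + \<epsilon>)) \<in> borel_measurable borel" by measurable
  then have "integrable lborel (\<lambda>x. 1 / (v x + \<epsilon>) * (\<phi> x)\<^sup>2)"
    by (rule integrable_bounded_mult_test[OF t2(1) _ bound[where q = "\<lambda>_. 1" and C = 1]]) simp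
  then have i2: "integrable lborel (\<lambda>x. (\<phi> x)\<^sup>2 / (v x + \<epsilon>))" by simp
  have i3: "integrable lborel (\<lambda>x. (dderiv b \<phi> x)\<^sup>2)" for b
    by (rule test_functions_integrable[OF t2(3)])
  have "(\<integral>x. (\<Sum>b\<in>Basis. X' b x) + lam * (\<phi> x)\<^sup>2 + \<delta> / 2 * ((\<phi> x)\<^sup>2 / (v x + \<epsilon>)) \<partial>lborel)
      \<le> (\<integral>x. (\<Sum>b\<in>Basis. (dderiv b \<phi> x)\<^sup>2) \<partial>lborel)"
    using i1 i2 i3 X'(1)
    by (intro integral_mono pw Bochner_Integration.integrable_add Bochner_Integration.integrable_sum
        integrable_mult_right)
  moreover have "(\<integral>x. (\<Sum>b\<in>Basis. X' b x) + lam * (\<phi> x)\<^sup>2 + \<delta> / 2 * ((\<phi> x)\<^sup>2 / (v x + \<epsilon>)) \<partial>lborel)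
      = (\<integral>x. (\<Sum>b\<in>Basis. X' b x) \<partial>lborel) + lam * (\<integral>x. (\<phi> x)\<^sup>2 \<partial>lborel)
        + \<delta> / 2 * (\<integral>x. (\<phi> x)\<^sup>2 / (v x + \<epsilon>) \<partial>lborel)"
  proof -
    have "integrable lborel (\<lambda>x. \<Sum>b\<in>Basis. X' b x)" using X'(1) by auto
    then show ?thesis using i1 i2 by (simp del: times_divide_eq_right times_divide_eq_left)
  qed
  moreover have "(\<integral>x. (\<Sum>b\<in>Basis. X' b x) \<partial>lborel) = 0"
    using X' by simp
  ultimately show ?thesis by linarith
qed

section \<open>Mollification of supersolutions\<close>

definition laplacian :: "('a::euclidean_space \<Rightarrow> real) \<Rightarrow> 'a \<Rightarrow> real" where
  "laplacian f x = (\<Sum>b\<in>Basis. dderiv b (dderiv b f) x)"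

lemma integral_reflect:
  fixes f :: "'a::euclidean_space \<Rightarrow> real"
  assumes f: "integrable lborel f"
  shows "(\<integral>y. f (x - y) \<partial>lborel) = (\<integral>y. f y \<partial>lborel)"
proof -
  have [measurable]: "f \<in> borel_measurable borel" using f by auto
  have "(\<integral>y. f y \<partial>lborel) = (\<integral>y. f y \<partial>distr lborel borel (\<lambda>y. x - y))"
    using lborel_affine[of "-1" x] by (simp add: density_1)
  also have "\<dots> = (\<integral>y. f (x - y) \<partial>lborel)"
    by (subst integral_distr) simp_all
  finally show ?thesis by simp
qed

text \<open>If the integral were 0, the zero set of \<open>f\<close> would be closed and of full
  measure, hence the whole space.\<close>

lemma integral_pos_continuous:
  fixes f :: "'a::euclidean_space \<Rightarrow> real"
  assumes c: "continuous_on UNIV f" and f: "\<And>x. 0 \<le> f x" "integrable lborel f" and x: "f x \<noteq> 0"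
  shows "0 < (\<integral>x. f x \<partial>lborel)"
proof -
  have "(\<integral>x. f x \<partial>lborel) \<noteq> 0"
  proof
    assume "(\<integral>x. f x \<partial>lborel) = 0"
    then have "AE x in lborel. f x = 0"
      using f by (subst (asm) integral_nonneg_eq_0_iff_AE) auto
    then have "AE x in lebesgue. x \<in> {x. f x = 0}" by (auto intro: AE_completion)
    moreover have "closed {x. f x = 0}"
      using c by (intro closed_Collect_eq) auto
    ultimately show False using x mem_closed_if_AE_lebesgue by blast
  qed
  moreover have "0 \<le> (\<integral>x. f x \<partial>lborel)" using f by simp
  ultimately show ?thesis by simp
qed

text \<open>Any nonzero test function can serve as a mollifier after squaring and rescaling,
  which makes an explicit bump function unnecessary.\<close>

lemma exists_mollifier:
  fixes \<phi> :: "'a::euclidean_space \<Rightarrow> real"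
  assumes \<phi>: "\<phi> \<in> test_functions V" "\<phi> z \<noteq> 0" and h: "0 < h"
  obtains \<eta> :: "'a \<Rightarrow> real" where "\<eta> \<in> test_functions UNIV" "\<And>x. 0 \<le> \<eta> x" "\<And>x. h < norm x \<Longrightarrow> \<eta> x = 0"
    "(\<integral>x. \<eta> x \<partial>lborel) = 1"
proof -
  obtain R where R: "R > 0" "\<And>x. R < norm x \<Longrightarrow> \<phi> x = 0"
    using test_functions_support_ball[OF \<phi>(1)] by blast
  \<comment> \<open>Contracts the radius of the support from \<open>R\<close> to
    \<open>h\<close>.\<close>
  define c where "c = R / h"
  have c: "c > 0" using R(1) h by (simp add: c_def)
  define \<psi> where "\<psi> x = \<phi> (0 + c *\<^sub>R x) * \<phi> (0 + c *\<^sub>R x)" for x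
  have sm: "smooth_on \<psi> UNIV"
    unfolding \<psi>_def[abs_def] using test_functionsD(1)[OF \<phi>(1)]
    by (intro smooth_on_mult smooth_on_affine)
  have supp: "\<psi> x = 0" if "h < norm x" for x
  proof -
    have "R < norm (c *\<^sub>R x)" using that c h R(1) by (simp add: c_def field_simps)
    then show ?thesis using R(2) by (simp add: \<psi>_def)
  qed
  have t: "\<psi> \<in> test_functions UNIV"
    by (rule test_functionsI[where K = "cball 0 h"]) (use sm supp in auto)
  have nn: "0 \<le> \<psi> x" for x by (simp add: \<psi>_def)
  have "\<psi> (z /\<^sub>R c) \<noteq> 0" using \<phi>(2) c by (simp add: \<psi>_def)
  then have pos: "0 < (\<integral>x. \<psi> x \<partial>lborel)" (is "0 < ?I")
    by (intro integral_pos_continuous test_functions_integrable[OF t] smooth_on_continuous[OF sm] nn)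
  show thesis
  proof (rule that[of "\<lambda>x. \<psi> x * (1 / ?I)"])
    show "(\<lambda>x. \<psi> x * (1 / ?I)) \<in> test_functions UNIV"
      by (rule test_functions_mult[OF t smooth_on_const])
  qed (use nn supp pos in auto)
qed

section \<open>Derivatives and Laplacian of a mollified function\<close>

lemma conv_test_has_dderiv:
  fixes U \<eta> :: "'a::euclidean_space \<Rightarrow> real"
  assumes U: "integrable lborel U" and \<eta>: "\<eta> \<in> test_functions S"
  shows "has_dderiv b (conv U \<eta>) (conv U (dderiv b \<eta>))"
proof -
  note \<eta>' = test_functions_dderiv[OF \<eta>, of b]
  obtain C where "\<And>x. \<bar>\<eta> x\<bar> \<le> C" using test_functions_bounded[OF \<eta>] by blast
  moreover obtain C' where "\<And>x. \<bar>dderiv b \<eta> x\<bar> \<le> C'" using test_functions_bounded[OF \<eta>'] by blast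
  ultimately show ?thesis
    using has_dderiv_conv[OF U smooth_has_dderiv] test_functionsD(1)[OF \<eta>] test_functionsD(1)[OF \<eta>']
    by (blast intro: smooth_on_borel)
qed

lemma conv_test_bounded:
  fixes U \<eta> :: "'a::euclidean_space \<Rightarrow> real"
  assumes U: "integrable lborel U" and \<eta>: "\<eta> \<in> test_functions S"
  shows "\<exists>C. \<forall>x. \<bar>conv U \<eta> x\<bar> \<le> C"
proof -
  obtain C where "\<And>x. \<bar>\<eta> x\<bar> \<le> C" using test_functions_bounded[OF \<eta>] by blast
  then show ?thesis
    using conv_bounded[OF U smooth_on_borel[OF test_functionsD(1)[OF \<eta>]]] by blast
qed

lemma conv_test_measurable:
  fixes U \<eta> :: "'a::euclidean_space \<Rightarrow> real"
  assumes "integrable lborel U" "\<eta> \<in> test_functions S"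
  shows "conv U \<eta> \<in> borel_measurable borel"
  using assms smooth_on_borel[OF test_functionsD(1)[OF assms(2)]] by (intro conv_measurable) auto

lemma dderiv_reflect:
  fixes f :: "'a::euclidean_space \<Rightarrow> real"
  assumes "smooth_on f UNIV"
  shows "dderiv b (\<lambda>y. f (x - y)) y = - dderiv b f (x - y)"
  using dderiv_affine[OF smooth_on_differentiable[OF assms], of b x "-1" y] by simp

text \<open>Each of the two derivatives contributes a factor -1, and these cancel.\<close>

lemma laplacian_reflect:
  fixes f :: "'a::euclidean_space \<Rightarrow> real"
  assumes "smooth_on f UNIV"
  shows "laplacian (\<lambda>y. f (x - y)) y = laplacian f (x - y)"
proof -
  have "dderiv b (dderiv b (\<lambda>y. f (x - y))) y = dderiv b (dderiv b f) (x - y)" for b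
  proof -
    have "dderiv b (\<lambda>y. f (x - y)) = (\<lambda>y. dderiv b f (x - y) * (-1))"
      by (simp add: fun_eq_iff dderiv_reflect[OF assms])
    \<comment> \<open>The second differentiation, stated for a general \<open>g\<close> and used
      with \<open>g = dderiv b f\<close>.\<close>
    moreover have "dderiv b (\<lambda>y. g (x - y) * (-1)) y = dderiv b g (x - y)"
      if "smooth_on g UNIV" for g :: "'a \<Rightarrow> real"
    proof -
      have "smooth_on (\<lambda>z. g z * (-1)) UNIV"
        using that by (intro smooth_on_mult smooth_on_const)
      moreover have "dderiv b (\<lambda>z. g z * (-1)) z = - dderiv b g z" for z
        using smooth_on_differentiable[OF that, of z]
        by (intro dderiv_eqI[THEN trans]) (auto simp: dderiv_def frechet_derivative_works intro!: derivative_eq_intros)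
      ultimately show ?thesis
        using dderiv_reflect[of "\<lambda>z. g z * (-1)" b x y] by simp
    qed
    ultimately show ?thesis using smooth_on_dderiv[OF assms] by metis
  qed
  then show ?thesis by (simp add: laplacian_def)
qed

text \<open>All derivatives fall on the kernel and its reflection costs no sign. Hence a weak
  inequality for \<open>U\<close>, tested with the reflected kernel, becomes a classical inequality
  for the mollification at \<open>x\<close>.\<close>

lemma conv_laplacian:
  fixes U \<eta> :: "'a::euclidean_space \<Rightarrow> real"
  assumes U: "integrable lborel U" and \<eta>: "\<eta> \<in> test_functions S"
  shows "(\<Sum>b\<in>Basis. conv U (dderiv b (dderiv b \<eta>)) x) = (\<integral>y. U y * laplacian (\<lambda>y. \<eta> (x - y)) y \<partial>lborel)"
proof -
  have "integrable lborel (\<lambda>y. U y * dderiv b (dderiv b \<eta>) (x - y))" for b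
  proof -
    note t = test_functions_dderiv[OF test_functions_dderiv[OF \<eta>], of b b]
    obtain C where "\<And>x. \<bar>dderiv b (dderiv b \<eta>) x\<bar> \<le> C" using test_functions_bounded[OF t] by blast
    then show ?thesis
      using U smooth_on_borel[OF test_functionsD(1)[OF t]] by (intro integrable_conv_kernel)
  qed
  then show ?thesis
    by (simp add: laplacian_reflect[OF test_functionsD(1)[OF \<eta>]] laplacian_def conv_def sum_distrib_left)
qed

text \<open>Picone's inequality for the mollified supersolution \<open>v\<close>; since \<open>v\<close> and \<open>U\<close> have the same
  integral, the resulting bound does not depend on the mollifier.\<close>

lemma supersolution_energy_bound:
  fixes U \<phi> :: "'a::euclidean_space \<Rightarrow> real"
  assumes V: "open V" "V \<in> lmeasurable"
    and U: "integrable lborel U" "\<And>x. 0 \<le> U x"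
    and super: "\<And>\<psi>. \<psi> \<in> test_functions V \<Longrightarrow> (\<And>x. 0 \<le> \<psi> x) \<Longrightarrow>
      lam * (\<integral>x. U x * \<psi> x \<partial>lborel) + \<delta> * (\<integral>x. \<psi> x \<partial>lborel) \<le> - (\<integral>x. U x * laplacian \<psi> x \<partial>lborel)"
    and \<phi>: "\<phi> \<in> test_functions V"
    and \<epsilon>: "0 < \<epsilon>" "lam * \<epsilon> \<le> \<delta> / 2" and \<delta>: "0 < \<delta>"
    and A: "A = (\<integral>x. U x \<partial>lborel) + \<epsilon> * measure lebesgue V" "0 < A"
  shows "lam * (\<integral>x. (\<phi> x)\<^sup>2 \<partial>lborel) + \<delta> / 2 * ((\<integral>x. \<phi> x \<partial>lborel)\<^sup>2 / A)
    \<le> (\<integral>x. (\<Sum>b\<in>Basis. (dderiv b \<phi> x)\<^sup>2) \<partial>lborel)"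
\<comment> \<open>The mollifier is built from a nonzero test function, here \<open>\<phi>\<close>
  itself, so the zero function is treated apart.\<close>
proof (cases "\<forall>x. \<phi> x = 0")
  case True
  then show ?thesis by (simp add: sum_nonneg)
next
  case False
  then obtain z where z: "\<phi> z \<noteq> 0" by blast
  let ?K = "closure {x. \<phi> x \<noteq> 0}"
  \<comment> \<open>With this radius, reflected kernels centred in the support of
    \<open>\<phi>\<close> are test functions on \<open>V\<close>, hence admissible in
    \<open>super\<close>.\<close>
  obtain h where h: "0 < h" "(\<Union>x\<in>?K. cball x h) \<subseteq> V"
    using compact_subset_open_imp_cball_epsilon_subset[OF test_functionsD(2)[OF \<phi>] V(1) test_functionsD(3)[OF \<phi>]]
    by blast
  obtain \<eta> :: "'a \<Rightarrow> real" where \<eta>: "\<eta> \<in> test_functions UNIV" "\<And>x. 0 \<le> \<eta> x" "\<And>x. h < norm x \<Longrightarrow> \<eta> x = 0"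
    and \<eta>1: "(\<integral>x. \<eta> x \<partial>lborel) = 1"
    using exists_mollifier[OF \<phi> z h(1)] by blast
  note sm = test_functionsD(1)[OF \<eta>(1)]
  have i\<eta>: "integrable lborel \<eta>" by (rule test_functions_integrable[OF \<eta>(1)])
  define v where "v = conv U \<eta>"
  have v0: "0 \<le> v x" for x
    unfolding v_def conv_def using U(2) \<eta>(2) by (intro Bochner_Integration.integral_nonneg) auto
  have sup: "lam * v x + \<delta> \<le> - (\<Sum>b\<in>Basis. conv U (dderiv b (dderiv b \<eta>)) x)" if x: "\<phi> x \<noteq> 0" for x
  proof -
    define \<psi> where "\<psi> y = \<eta> (x - y)" for y
    have "x \<in> ?K" using x closure_subset[of "{x. \<phi> x \<noteq> 0}"] by auto
    have "\<psi> \<in> test_functions V"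
    proof (rule test_functionsI)
      show "smooth_on \<psi> UNIV"
        using smooth_on_affine[OF sm, of x "-1"] by (simp add: \<psi>_def[abs_def])
      show "compact (cball x h)" by simp
      show "cball x h \<subseteq> V" using h(2) \<open>x \<in> ?K\<close> by blast
      show "\<psi> y = 0" if "y \<notin> cball x h" for y
        using that \<eta>(3)[of "x - y"] by (simp add: \<psi>_def dist_norm)
    qed
    from super[OF this] \<eta>(2) have
      "lam * (\<integral>x. U x * \<psi> x \<partial>lborel) + \<delta> * (\<integral>x. \<psi> x \<partial>lborel) \<le> - (\<integral>x. U x * laplacian \<psi> x \<partial>lborel)"
      by (simp add: \<psi>_def)
    then show ?thesis
      unfolding conv_laplacian[OF U(1) \<eta>(1)] \<psi>_def integral_reflect[OF i\<eta>] \<eta>1 v_def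
      by (simp add: conv_def)
  qed
  have picone: "lam * (\<integral>x. (\<phi> x)\<^sup>2 \<partial>lborel) + \<delta> / 2 * (\<integral>x. (\<phi> x)\<^sup>2 / (v x + \<epsilon>) \<partial>lborel)
    \<le> (\<integral>x. (\<Sum>b\<in>Basis. (dderiv b \<phi> x)\<^sup>2) \<partial>lborel)"
  proof (rule integral_picone[where v' = "\<lambda>b. conv U (dderiv b \<eta>)"
        and v'' = "\<lambda>b. conv U (dderiv b (dderiv b \<eta>))"])
    note t = \<eta>(1) test_functions_dderiv[OF \<eta>(1)] test_functions_dderiv[OF test_functions_dderiv[OF \<eta>(1)]]
    show "v \<in> borel_measurable borel" unfolding v_def by (rule conv_test_measurable[OF U(1) t(1)])
    show "has_dderiv b v (conv U (dderiv b \<eta>))" for b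
      unfolding v_def by (rule conv_test_has_dderiv[OF U(1) t(1)])
    show "has_dderiv b (conv U (dderiv b \<eta>)) (conv U (dderiv b (dderiv b \<eta>)))" for b
      by (rule conv_test_has_dderiv[OF U(1) t(2)])
    show "conv U (dderiv b \<eta>) \<in> borel_measurable borel" for b
      by (rule conv_test_measurable[OF U(1) t(2)])
    show "conv U (dderiv b (dderiv b \<eta>)) \<in> borel_measurable borel" for b
      by (rule conv_test_measurable[OF U(1) t(3)])
    show "\<exists>C. \<forall>x. \<bar>conv U (dderiv b \<eta>) x\<bar> \<le> C" for b
      by (rule conv_test_bounded[OF U(1) t(2)])
    show "\<exists>C. \<forall>x. \<bar>conv U (dderiv b (dderiv b \<eta>)) x\<bar> \<le> C" for b
      by (rule conv_test_bounded[OF U(1) t(3)])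
  qed (use \<phi> v0 sup \<epsilon> in auto)
  \<comment> \<open>Cauchy-Schwarz for \<open>\<phi> / sqrt (v + \<epsilon>)\<close> and
    \<open>sqrt (v + \<epsilon>)\<close> on \<open>V\<close>, where the integral of
    \<open>v + \<epsilon>\<close> is at most \<open>A\<close>.\<close>
  have "(\<integral>x. \<phi> x \<partial>lborel)\<^sup>2 / A \<le> (\<integral>x. (\<phi> x)\<^sup>2 / (v x + \<epsilon>) \<partial>lborel)"
  proof -
    \<comment> \<open>The maximizer of \<open>2 * s * I - s^2 * A\<close>, where \<open>I\<close> is
      the integral of \<open>\<phi>\<close>; the maximum is \<open>I^2 / A\<close>.\<close>
    define s where "s = (\<integral>x. \<phi> x \<partial>lborel) / A"
    have iv: "integrable lborel v" "(\<integral>x. v x \<partial>lborel) = (\<integral>x. U x \<partial>lborel)"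
      unfolding v_def using integrable_conv[OF U(1) i\<eta>] integral_conv[OF U(1) i\<eta>] \<eta>1 by simp_all
    have Vb: "V \<in> sets lborel" using V(1) by simp
    have "emeasure lborel V = emeasure lebesgue V" using Vb by (simp add: emeasure_completion)
    then have mV: "measure lebesgue V = measure lborel V" "emeasure lborel V < \<infinity>"
      using V(2) by (simp_all add: measure_def fmeasurable_def del: emeasure_completion)
    have iI: "integrable lborel (indicat_real V)" using Vb mV(2) by (simp add: integrable_real_indicator)
    have i2: "integrable lborel (\<lambda>x. (\<phi> x)\<^sup>2 / (v x + \<epsilon>))"
    proof -
      have "(\<lambda>x. \<phi> x * \<phi> x) \<in> test_functions V"
        by (rule test_functions_mult[OF \<phi> test_functionsD(1)[OF \<phi>]])
      moreover have "\<bar>1 / (v x + \<epsilon>)\<bar> \<le> 1 / \<epsilon>" for x using v0[of x] \<epsilon>(1) by (simp add: frac_le)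
      moreover have "(\<lambda>x. 1 / (v x + \<epsilon>)) \<in> borel_measurable borel" using iv(1) by measurable
      ultimately have "integrable lborel (\<lambda>x. 1 / (v x + \<epsilon>) * (\<phi> x * \<phi> x))"
        by (intro integrable_bounded_mult_test)
      then show ?thesis by (simp add: power2_eq_square)
    qed
    have i\<phi>: "integrable lborel \<phi>" by (rule test_functions_integrable[OF \<phi>])
    \<comment> \<open>On \<open>V\<close> this expresses that \<open>(\<phi> x - s * (v x +
      \<epsilon>))\<^sup>2 / (v x + \<epsilon>)\<close> is nonnegative; outside \<open>V\<close> the
      terms with \<open>\<phi>\<close> vanish and the left side is at most 0.\<close>
    have "2 * s * \<phi> x - s\<^sup>2 * v x - s\<^sup>2 * \<epsilon> * indicator V x \<le> (\<phi> x)\<^sup>2 / (v x + \<epsilon>)" for x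
    proof (cases "x \<in> V")
      case True
      have w: "0 < v x + \<epsilon>" using v0[of x] \<epsilon>(1) by simp
      have "0 \<le> (\<phi> x - s * (v x + \<epsilon>))\<^sup>2 / (v x + \<epsilon>)" using w by simp
      also have "\<dots> = (\<phi> x)\<^sup>2 / (v x + \<epsilon>) - 2 * s * \<phi> x + s\<^sup>2 * (v x + \<epsilon>)"
      proof -
        have "(p - s * w)\<^sup>2 / w = p\<^sup>2 / w - 2 * s * p + s\<^sup>2 * w" if "w > 0" for p w :: real
          using that by (simp add: field_simps power2_eq_square)
        then show ?thesis using w by blast
      qed
      finally show ?thesis using True by (simp add: algebra_simps)
    next
      case False
      then show ?thesis using v0[of x] test_functions_zero[OF \<phi> False] by simp
    qed
    then have "(\<integral>x. 2 * s * \<phi> x - s\<^sup>2 * v x - s\<^sup>2 * \<epsilon> * indicator V x \<partial>lborel)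
        \<le> (\<integral>x. (\<phi> x)\<^sup>2 / (v x + \<epsilon>) \<partial>lborel)"
      using i\<phi> iv(1) iI i2 by (intro integral_mono) auto
    moreover have "(\<integral>x. 2 * s * \<phi> x - s\<^sup>2 * v x - s\<^sup>2 * \<epsilon> * indicator V x \<partial>lborel)
        = 2 * s * (\<integral>x. \<phi> x \<partial>lborel) - s\<^sup>2 * A"
      using i\<phi> iv iI Vb mV by (simp add: A(1) algebra_simps)
    moreover have "2 * s * (\<integral>x. \<phi> x \<partial>lborel) - s\<^sup>2 * A = (\<integral>x. \<phi> x \<partial>lborel)\<^sup>2 / A"
      using A(2) by (simp add: s_def power2_eq_square field_simps)
    ultimately show ?thesis by simp
  qed
  then have "\<delta> / 2 * ((\<integral>x. \<phi> x \<partial>lborel)\<^sup>2 / A) \<le> \<delta> / 2 * (\<integral>x. (\<phi> x)\<^sup>2 / (v x + \<epsilon>) \<partial>lborel)"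
    using \<delta> by (intro mult_left_mono) auto
  with picone show ?thesis by linarith
qed

section \<open>Square integrable functions\<close>

lemma integrable_inner_L2:
  fixes f g :: "'a \<Rightarrow> 'b::euclidean_space"
  assumes [measurable]: "f \<in> borel_measurable M" "g \<in> borel_measurable M"
    and "integrable M (\<lambda>x. (norm (f x))\<^sup>2)" "integrable M (\<lambda>x. (norm (g x))\<^sup>2)"
  shows "integrable M (\<lambda>x. f x \<bullet> g x)"
proof (rule Bochner_Integration.integrable_bound)
  show "integrable M (\<lambda>x. (norm (f x))\<^sup>2 + (norm (g x))\<^sup>2)" using assms by auto
  show "(\<lambda>x. f x \<bullet> g x) \<in> borel_measurable M" by measurable
  have "\<bar>f x \<bullet> g x\<bar> \<le> (norm (f x))\<^sup>2 + (norm (g x))\<^sup>2" for x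
    using Cauchy_Schwarz_ineq2[of "f x" "g x"] sum_squares_bound[of "norm (f x)" "norm (g x)"]
      mult_nonneg_nonneg[OF norm_ge_zero norm_ge_zero, of "f x" "g x"] by linarith
  then show "AE x in M. norm (f x \<bullet> g x) \<le> norm ((norm (f x))\<^sup>2 + (norm (g x))\<^sup>2)"
    by simp
qed

lemma L2_integrable_inner: "f \<in> L2 U \<Longrightarrow> g \<in> L2 U \<Longrightarrow> integrable (lebesgue_on U) (\<lambda>x. f x \<bullet> g x)"
  unfolding L2_def by (auto intro: integrable_inner_L2)

lemma L2_integrable_norm: "f \<in> L2 U \<Longrightarrow> integrable (lebesgue_on U) (\<lambda>x. (norm (f x))\<^sup>2)"
  by (simp add: L2_def)

lemma L2_diff: "f \<in> L2 U \<Longrightarrow> g \<in> L2 U \<Longrightarrow> (\<lambda>x. f x - g x) \<in> L2 U"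
proof -
  assume fg: "f \<in> L2 U" "g \<in> L2 U"
  have "integrable (lebesgue_on U) (\<lambda>x. (norm (f x))\<^sup>2 + (norm (g x))\<^sup>2 - 2 * (f x \<bullet> g x))"
    using L2_integrable_inner[OF fg] L2_integrable_norm[OF fg(1)] L2_integrable_norm[OF fg(2)] by auto
  moreover have "(norm (f x))\<^sup>2 + (norm (g x))\<^sup>2 - 2 * (f x \<bullet> g x) = (norm (f x - g x))\<^sup>2" for x
    by (simp add: power2_norm_eq_inner algebra_simps inner_commute)
  ultimately show ?thesis using fg by (auto simp: L2_def intro: borel_measurable_diff)
qed

text \<open>A lossy Cauchy-Schwarz inequality: the extra 1 keeps the denominator of \<open>t\<close>
  positive even if \<open>f\<close> vanishes, and is harmless where the right side only has to tend
  to 0.\<close>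

lemma L2_inner_bound:
  assumes "f \<in> L2 U" "g \<in> L2 U"
  shows "(LINT x|lebesgue_on U. f x \<bullet> g x)\<^sup>2 \<le>
    ((LINT x|lebesgue_on U. (norm (f x))\<^sup>2) + 1) * (LINT x|lebesgue_on U. (norm (g x))\<^sup>2)"
proof -
  let ?I = "LINT x|lebesgue_on U. f x \<bullet> g x"
    and ?F = "LINT x|lebesgue_on U. (norm (f x))\<^sup>2" and ?G = "LINT x|lebesgue_on U. (norm (g x))\<^sup>2"
  \<comment> \<open>The minimizer of \<open>?G - 2 * t * ?I + t\<^sup>2 * (?F + 1)\<close>.\<close>
  define t where "t = ?I / (?F + 1)"
  have F: "?F \<ge> 0" by simp
  note i = L2_integrable_inner[OF assms] L2_integrable_norm[OF assms(1)] L2_integrable_norm[OF assms(2)]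
  have "(norm (g x - t *\<^sub>R f x))\<^sup>2 = (norm (g x))\<^sup>2 - 2 * t * (f x \<bullet> g x) + t\<^sup>2 * (norm (f x))\<^sup>2" for x
    unfolding power2_norm_eq_inner by (simp add: algebra_simps inner_commute power2_eq_square)
  then have "0 \<le> (LINT x|lebesgue_on U. (norm (g x))\<^sup>2 - 2 * t * (f x \<bullet> g x) + t\<^sup>2 * (norm (f x))\<^sup>2)"
    by (metis (no_types, lifting) Bochner_Integration.integral_nonneg zero_le_power2)
  also have "\<dots> = ?G - 2 * t * ?I + t\<^sup>2 * ?F"
    using i by simp
  also have "\<dots> \<le> ?G - 2 * t * ?I + t\<^sup>2 * (?F + 1)"
    by (simp add: algebra_simps)
  also have "\<dots> = ?G - t * ?I"
  proof -
    have "?F + 1 \<noteq> 0" using F by linarith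
    then have "t * (?F + 1) = ?I" by (simp add: t_def)
    then have "t\<^sup>2 * (?F + 1) = t * ?I" unfolding power2_eq_square mult.assoc by (rule arg_cong)
    then show ?thesis by linarith
  qed
  also have "\<dots> = ?G - ?I\<^sup>2 / (?F + 1)"
    by (simp add: t_def power2_eq_square )
  finally show ?thesis using F by (simp add: field_simps)
qed

text \<open>Strong convergence implies weak convergence by \<open>L2_inner_bound\<close>. Expanding
  \<open>(norm (a n x - f x))\<^sup>2\<close> then gives convergence of norms, the cross term being
  the weak limit with \<open>c = f\<close>.\<close>

lemma
  fixes a :: "nat \<Rightarrow> 'a::euclidean_space \<Rightarrow> 'b::euclidean_space"
  assumes a: "\<And>n. a n \<in> L2 U" and f: "f \<in> L2 U"
    and lim: "(\<lambda>n. LINT x|lebesgue_on U. (norm (a n x - f x))\<^sup>2) \<longlonglongrightarrow> 0"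
  shows L2_tendsto_inner: "c \<in> L2 U \<Longrightarrow>
      (\<lambda>n. LINT x|lebesgue_on U. c x \<bullet> a n x) \<longlonglongrightarrow> (LINT x|lebesgue_on U. c x \<bullet> f x)"
    and L2_tendsto_norm:
      "(\<lambda>n. LINT x|lebesgue_on U. (norm (a n x))\<^sup>2) \<longlonglongrightarrow> (LINT x|lebesgue_on U. (norm (f x))\<^sup>2)"
proof -
  show *: "(\<lambda>n. LINT x|lebesgue_on U. c x \<bullet> a n x) \<longlonglongrightarrow> (LINT x|lebesgue_on U. c x \<bullet> f x)"
    if c: "c \<in> L2 U" for c
  proof -
    have "(\<lambda>n. (LINT x|lebesgue_on U. c x \<bullet> (a n x - f x))\<^sup>2) \<longlonglongrightarrow> 0"
    proof (rule tendsto_sandwich[OF _ _ tendsto_const])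
      show "(\<lambda>n. ((LINT x|lebesgue_on U. (norm (c x))\<^sup>2) + 1) *
          (LINT x|lebesgue_on U. (norm (a n x - f x))\<^sup>2)) \<longlonglongrightarrow> 0"
        using lim by (rule tendsto_mult_right_zero)
      show "\<forall>\<^sub>F n in sequentially. (LINT x|lebesgue_on U. c x \<bullet> (a n x - f x))\<^sup>2 \<le>
          ((LINT x|lebesgue_on U. (norm (c x))\<^sup>2) + 1) * (LINT x|lebesgue_on U. (norm (a n x - f x))\<^sup>2)"
        by (intro always_eventually allI L2_inner_bound c L2_diff a f)
    qed auto
    then have "(\<lambda>n. LINT x|lebesgue_on U. c x \<bullet> (a n x - f x)) \<longlonglongrightarrow> 0"
      by (simp add: power_tendsto_0_iff)
    moreover have "(LINT x|lebesgue_on U. c x \<bullet> (a n x - f x)) =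
        (LINT x|lebesgue_on U. c x \<bullet> a n x) - (LINT x|lebesgue_on U. c x \<bullet> f x)" for n
      using L2_integrable_inner[OF c a] L2_integrable_inner[OF c f] by (simp add: inner_diff_right)
    ultimately show ?thesis by (simp add: LIM_zero_iff)
  qed
  have "(LINT x|lebesgue_on U. (norm (a n x))\<^sup>2) = (LINT x|lebesgue_on U. (norm (a n x - f x))\<^sup>2)
      + 2 * (LINT x|lebesgue_on U. f x \<bullet> a n x) - (LINT x|lebesgue_on U. (norm (f x))\<^sup>2)" for n
  proof -
    have "(norm (a n x))\<^sup>2 = (norm (a n x - f x))\<^sup>2 + 2 * (f x \<bullet> a n x) - (norm (f x))\<^sup>2" for x
      by (simp add: power2_norm_eq_inner algebra_simps inner_commute)
    then show ?thesis
      using L2_integrable_inner[OF f a] L2_integrable_norm[OF L2_diff[OF a f]] L2_integrable_norm[OF f]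
      by simp
  qed
  moreover have "(\<lambda>n. (LINT x|lebesgue_on U. (norm (a n x - f x))\<^sup>2)
      + 2 * (LINT x|lebesgue_on U. f x \<bullet> a n x) - (LINT x|lebesgue_on U. (norm (f x))\<^sup>2))
      \<longlonglongrightarrow> 0 + 2 * (LINT x|lebesgue_on U. f x \<bullet> f x) - (LINT x|lebesgue_on U. (norm (f x))\<^sup>2)"
    by (intro tendsto_intros lim *[OF f])
  ultimately show "(\<lambda>n. LINT x|lebesgue_on U. (norm (a n x))\<^sup>2) \<longlonglongrightarrow> (LINT x|lebesgue_on U. (norm (f x))\<^sup>2)"
    by (simp add: power2_norm_eq_inner)
qed

lemma L2_const: "U \<in> lmeasurable \<Longrightarrow> (\<lambda>_. c) \<in> L2 U"
  by (auto simp: L2_def intro: finite_measure.integrable_const finite_measure_lebesgue_on)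

lemma L2_integrable:
  fixes f :: "'a::euclidean_space \<Rightarrow> real"
  shows "U \<in> lmeasurable \<Longrightarrow> f \<in> L2 U \<Longrightarrow> integrable (lebesgue_on U) f"
  using L2_integrable_inner[OF _ L2_const[of U 1], of f] by simp

lemma L2_mono:
  assumes "f \<in> L2 U" "V \<subseteq> U" "V \<in> sets lebesgue" "U \<in> sets lebesgue"
  shows "f \<in> L2 V"
proof -
  have "f \<in> borel_measurable (lebesgue_on V)"
    using assms by (auto simp: L2_def intro: measurable_restrict_mono)
  have "set_integrable lebesgue U (\<lambda>x. (norm (f x))\<^sup>2)"
    using assms by (simp add: L2_def set_integrable_def integrable_restrict_space)
  then have "set_integrable lebesgue V (\<lambda>x. (norm (f x))\<^sup>2)"
    by (rule set_integrable_subset[OF _ assms(3,2)])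
  then have "integrable (lebesgue_on V) (\<lambda>x. (norm (f x))\<^sup>2)"
    using assms by (simp add: set_integrable_def integrable_restrict_space)
  with \<open>f \<in> borel_measurable (lebesgue_on V)\<close> show ?thesis by (simp add: L2_def)
qed

section \<open>Integrals of test functions over a set\<close>

text \<open>Links integrals over \<open>V\<close>, as in the definitions of the function spaces, to
  integrals over the whole space, and so compares integrals over nested sets.\<close>

lemma
  fixes f :: "'a::euclidean_space \<Rightarrow> 'b::euclidean_space"
  assumes V: "V \<in> sets lebesgue" and f: "\<And>x. x \<notin> V \<Longrightarrow> f x = 0"
  shows LINT_lebesgue_on_eq: "(LINT x|lebesgue_on V. f x) = (LINT x|lebesgue. f x)"
    and integrable_lebesgue_on_iff: "integrable (lebesgue_on V) f \<longleftrightarrow> integrable lebesgue f"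
proof -
  have "indicator V x *\<^sub>R f x = f x" for x using f by (auto simp: indicator_def)
  then show "(LINT x|lebesgue_on V. f x) = (LINT x|lebesgue. f x)"
    "integrable (lebesgue_on V) f \<longleftrightarrow> integrable lebesgue f"
    using V by (simp_all add: integral_restrict_space integrable_restrict_space)
qed

lemma LINT_lebesgue_on_test:
  assumes "\<phi> \<in> test_functions V" "V \<in> sets lebesgue"
  shows "(LINT x|lebesgue_on V. \<phi> x) = (\<integral>x. \<phi> x \<partial>lborel)"
    "integrable (lebesgue_on V) \<phi>"
proof -
  have m: "\<phi> \<in> borel_measurable lborel"
    using smooth_on_borel[OF test_functionsD(1)[OF assms(1)]] by simp
  show "(LINT x|lebesgue_on V. \<phi> x) = (\<integral>x. \<phi> x \<partial>lborel)"
    using test_functions_zero[OF assms(1)] m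
    by (subst LINT_lebesgue_on_eq[OF assms(2)]) (auto simp: integral_completion)
  show "integrable (lebesgue_on V) \<phi>"
    using test_functions_zero[OF assms(1)] m test_functions_integrable[OF assms(1)]
    by (subst integrable_lebesgue_on_iff[OF assms(2)]) (auto simp: integrable_completion)
qed

lemma norm_grad: "(norm (grad \<phi> x))\<^sup>2 = (\<Sum>b\<in>Basis. (dderiv b \<phi> x)\<^sup>2)"
  unfolding power2_norm_eq_inner
  by (subst euclidean_inner) (simp add: inner_grad power2_eq_square)

lemma test_functions_L2:
  assumes "\<phi> \<in> test_functions V" "V \<in> sets lebesgue"
  shows "\<phi> \<in> L2 V" "grad \<phi> \<in> L2 V"
proof -
  have m: "\<psi> \<in> borel_measurable (lebesgue_on V)" if "smooth_on \<psi> UNIV" for \<psi> :: "'a \<Rightarrow> real"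
    using smooth_on_borel[OF that]
    by (intro measurable_restrict_space1 measurable_completion) simp
  have sq: "integrable (lebesgue_on V) (\<lambda>x. (\<psi> x)\<^sup>2)" if "\<psi> \<in> test_functions V" for \<psi> :: "'a \<Rightarrow> real"
    using LINT_lebesgue_on_test(2)[OF test_functions_mult[OF that test_functionsD(1)[OF that]] assms(2)]
    by (simp add: power2_eq_square)
  show "\<phi> \<in> L2 V"
    using m[OF test_functionsD(1)[OF assms(1)]] sq[OF assms(1)] by (simp add: L2_def)
  have "grad \<phi> \<in> borel_measurable (lebesgue_on V)"
    unfolding grad_eq_dderiv[abs_def]
    using m[OF smooth_on_dderiv[OF test_functionsD(1)[OF assms(1)]]] by measurable
  then show "grad \<phi> \<in> L2 V"
    using sq[OF test_functions_dderiv[OF assms(1)]] by (simp add: L2_def norm_grad)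
qed

section \<open>Weak equations in distributional form\<close>

lemma laplacian_zero_outside:
  "\<phi> \<in> test_functions V \<Longrightarrow> x \<notin> V \<Longrightarrow> laplacian \<phi> x = 0"
  unfolding laplacian_def
  by (intro sum.neutral ballI test_functions_zero[OF test_functions_dderiv[OF test_functions_dderiv]])

text \<open>Testing the weak gradient with \<open>dderiv b \<phi>\<close> and taking the component
  in direction \<open>b\<close> gives one second derivative; summing over the basis gives the
  Laplacian.\<close>

lemma weak_gradient_laplacian:
  fixes u :: "'a::euclidean_space \<Rightarrow> real"
  assumes U: "U \<in> sets lebesgue" and g: "has_weak_gradient U u g" and \<phi>: "\<phi> \<in> test_functions U"
  shows "(LINT x|lebesgue_on U. u x * laplacian \<phi> x) = - (LINT x|lebesgue_on U. g x \<bullet> grad \<phi> x)"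
proof -
  have i: "integrable (lebesgue_on U) (\<lambda>x. \<psi> x *\<^sub>R f x)"
    if "\<psi> \<in> test_functions U" "locally_integrable U f" for \<psi> and f :: "'a \<Rightarrow> 'c::euclidean_space"
    using test_functions_integrable_mult[OF that] test_functions_zero[OF that(1)]
    by (subst integrable_lebesgue_on_iff[OF U]) auto
  have lu: "locally_integrable U u" and lg: "locally_integrable U g"
    using g by (auto simp: has_weak_gradient_def)
  have b: "(LINT x|lebesgue_on U. u x * dderiv b (dderiv b \<phi>) x) =
      - (LINT x|lebesgue_on U. dderiv b \<phi> x * (g x \<bullet> b))" if b: "b \<in> Basis" for b
  proof -
    define \<psi> where "\<psi> = dderiv b \<phi>"
    have \<psi>: "\<psi> \<in> test_functions U" unfolding \<psi>_def by (rule test_functions_dderiv[OF \<phi>])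
    \<comment> \<open>Integrability is what allows the inner product with \<open>b\<close> to move
      under the integral.\<close>
    have "integrable (lebesgue_on U) (\<lambda>x. \<Sum>c\<in>Basis. (dderiv c \<psi> x *\<^sub>R u x) *\<^sub>R c)"
      by (intro Bochner_Integration.integrable_sum integrable_scaleR_left i lu test_functions_dderiv \<psi>)
    then have iu: "integrable (lebesgue_on U) (\<lambda>x. u x *\<^sub>R grad \<psi> x)"
      by (simp add: grad_eq_dderiv scaleR_sum_right mult.commute)
    have "(LINT x|lebesgue_on U. u x *\<^sub>R grad \<psi> x) \<bullet> b = - (LINT x|lebesgue_on U. \<psi> x *\<^sub>R g x) \<bullet> b"
      using g \<psi> by (simp add: has_weak_gradient_def)
    moreover have "(LINT x|lebesgue_on U. u x *\<^sub>R grad \<psi> x) \<bullet> b = (LINT x|lebesgue_on U. u x * dderiv b \<psi> x)"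
      using iu b by (simp flip: integral_inner_left add: inner_grad)
    moreover have "(LINT x|lebesgue_on U. \<psi> x *\<^sub>R g x) \<bullet> b = (LINT x|lebesgue_on U. \<psi> x * (g x \<bullet> b))"
      using i[OF \<psi> lg] by (simp flip: integral_inner_left)
    ultimately show ?thesis by (simp add: \<psi>_def)
  qed
  have "(LINT x|lebesgue_on U. u x * laplacian \<phi> x) =
      (\<Sum>b\<in>Basis. LINT x|lebesgue_on U. u x * dderiv b (dderiv b \<phi>) x)"
    using i[OF test_functions_dderiv[OF test_functions_dderiv[OF \<phi>]] lu]
    by (simp add: laplacian_def sum_distrib_left mult.commute)
  also have "\<dots> = - (\<Sum>b\<in>Basis. LINT x|lebesgue_on U. dderiv b \<phi> x * (g x \<bullet> b))"
    by (simp add: b sum_negf)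
  also have "(\<Sum>b\<in>Basis. LINT x|lebesgue_on U. dderiv b \<phi> x * (g x \<bullet> b)) =
      (LINT x|lebesgue_on U. g x \<bullet> grad \<phi> x)"
  proof -
    have "integrable (lebesgue_on U) (\<lambda>x. dderiv b \<phi> x * (g x \<bullet> b))" for b
      using integrable_inner_left[of b "lebesgue_on U" "\<lambda>x. dderiv b \<phi> x *\<^sub>R g x"]
        i[OF test_functions_dderiv[OF \<phi>, of b] lg] by simp
    then show ?thesis
      by (simp add: grad_eq_dderiv inner_sum_right)
  qed
  finally show ?thesis .
qed

text \<open>With the gradient eliminated, the equation passes to smaller sets: a test function on
  \<open>V\<close> is one on \<open>U\<close>, and its integrals over \<open>U\<close> and
  \<open>V\<close> agree.\<close>

lemma weak_poisson_laplacian: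
  fixes u f :: "'a::euclidean_space \<Rightarrow> real"
  assumes "weak_poisson U u f" "V \<subseteq> U" "V \<in> sets lebesgue" "U \<in> sets lebesgue" "\<phi> \<in> test_functions V"
  shows "(LINT x|lebesgue_on V. u x * laplacian \<phi> x) = - (LINT x|lebesgue_on V. f x * \<phi> x)"
proof -
  have \<phi>: "\<phi> \<in> test_functions U" using assms(2,5) test_functions_mono by blast
  obtain g where g: "has_weak_gradient U u g"
    "(LINT x|lebesgue_on U. g x \<bullet> grad \<phi> x) = (LINT x|lebesgue_on U. f x * \<phi> x)"
    using assms(1) \<phi> by (auto simp: weak_poisson_def)
  have "(LINT x|lebesgue_on U. u x * laplacian \<phi> x) = - (LINT x|lebesgue_on U. f x * \<phi> x)"
    using weak_gradient_laplacian[OF assms(4) g(1) \<phi>] g(2) by simp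
  then show ?thesis
    using laplacian_zero_outside[OF assms(5)] test_functions_zero[OF assms(5)]
      laplacian_zero_outside[OF \<phi>] test_functions_zero[OF \<phi>]
    by (simp add: LINT_lebesgue_on_eq[OF assms(3)] LINT_lebesgue_on_eq[OF assms(4)])
qed

section \<open>Nonexistence of nonnegative supersolutions\<close>

lemma measure_open_pos:
  fixes V :: "'a::euclidean_space set"
  assumes "open V" "V \<in> lmeasurable" "V \<noteq> {}"
  shows "0 < measure lebesgue V"
proof (rule ccontr)
  assume "\<not> 0 < measure lebesgue V"
  then have "measure lebesgue V = 0" by (simp add: not_less measure_le_0_iff)
  then have "V \<in> null_sets lebesgue"
    using assms(2) by (simp add: negligible_iff_measure flip: negligible_iff_null_sets)
  then have "AE x\<in>V in lebesgue. x \<in> {}" by (auto dest: AE_not_in)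
  then show False using mem_closed_if_AE_lebesgue_open[OF assms(1), of "{}"] assms(3) by auto
qed

text \<open>The energy bound for test functions approximating \<open>e\<close> survives in the limit
  with a strictly positive gain, as the mean of \<open>e\<close> is nonzero. This contradicts the
  energy identity of the eigenfunction.\<close>

lemma no_nonneg_supersolution:
  fixes U e :: "'a::euclidean_space \<Rightarrow> real"
  assumes V: "open V" "V \<in> lmeasurable" "V \<noteq> {}"
    and e: "e \<in> H10 V" "(LINT x|lebesgue_on V. e x) \<noteq> 0"
    and eigen: "\<And>\<phi>. \<phi> \<in> test_functions V \<Longrightarrow>
      (LINT x|lebesgue_on V. e x * laplacian \<phi> x) = - (LINT x|lebesgue_on V. lam * e x * \<phi> x)"
    and U: "integrable lborel U" "\<And>x. 0 \<le> U x" and \<delta>: "0 < \<delta>"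
    and super: "\<And>\<psi>. \<psi> \<in> test_functions V \<Longrightarrow> (\<And>x. 0 \<le> \<psi> x) \<Longrightarrow>
      lam * (\<integral>x. U x * \<psi> x \<partial>lborel) + \<delta> * (\<integral>x. \<psi> x \<partial>lborel) \<le> - (\<integral>x. U x * laplacian \<psi> x \<partial>lborel)"
  shows False
proof -
  have Vs: "V \<in> sets lebesgue" using V(1) by simp
  obtain g \<phi> where eL: "e \<in> L2 V" and g: "g \<in> L2 V" "has_weak_gradient V e g"
    and \<phi>: "\<And>n::nat. \<phi> n \<in> test_functions V"
    and lim: "(\<lambda>n. LINT x|lebesgue_on V. (\<phi> n x - e x)\<^sup>2) \<longlonglongrightarrow> 0"
      "(\<lambda>n. LINT x|lebesgue_on V. (norm (grad (\<phi> n) x - g x))\<^sup>2) \<longlonglongrightarrow> 0"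
    using e(1) unfolding H10_def by blast
  note \<phi>L = test_functions_L2[OF \<phi> Vs]
  have lim': "(\<lambda>n. LINT x|lebesgue_on V. (norm (\<phi> n x - e x))\<^sup>2) \<longlonglongrightarrow> 0"
    using lim(1) by simp
  let ?E = "LINT x|lebesgue_on V. (e x)\<^sup>2" and ?G = "LINT x|lebesgue_on V. (norm (g x))\<^sup>2"
    and ?m = "LINT x|lebesgue_on V. e x"
  \<comment> \<open>One sequence with two limits: the gradient energy of \<open>e\<close> and, by
    the equation for \<open>e\<close> tested with \<open>\<phi> n\<close>, \<open>lam\<close> times
    its squared norm.\<close>
  have "(\<lambda>n. LINT x|lebesgue_on V. g x \<bullet> grad (\<phi> n) x) \<longlonglongrightarrow> (LINT x|lebesgue_on V. g x \<bullet> g x)"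
    by (rule L2_tendsto_inner[OF \<phi>L(2) g(1) lim(2) g(1)])
  moreover have "(\<lambda>n. LINT x|lebesgue_on V. g x \<bullet> grad (\<phi> n) x) \<longlonglongrightarrow> lam * (LINT x|lebesgue_on V. e x \<bullet> e x)"
  proof -
    have "(LINT x|lebesgue_on V. g x \<bullet> grad (\<phi> n) x) = lam * (LINT x|lebesgue_on V. e x \<bullet> \<phi> n x)" for n
      using weak_gradient_laplacian[OF Vs g(2) \<phi>, of n] eigen[OF \<phi>, of n] by (simp add: mult.assoc)
    then show ?thesis
      using tendsto_mult_left[OF L2_tendsto_inner[OF \<phi>L(1) eL lim' eL], of lam] by simp
  qed
  ultimately have "(LINT x|lebesgue_on V. g x \<bullet> g x) = lam * (LINT x|lebesgue_on V. e x \<bullet> e x)"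
    by (rule LIMSEQ_unique)
  then have energy: "?G = lam * ?E"
    by (simp add: power2_norm_eq_inner) (simp add: power2_eq_square)
  \<comment> \<open>Works for either sign of \<open>lam\<close>; adding 1 keeps the denominator
    positive when \<open>lam\<close> is 0.\<close>
  define \<epsilon> where "\<epsilon> = \<delta> / (2 * (\<bar>lam\<bar> + 1))"
  have \<epsilon>: "0 < \<epsilon>" "lam * \<epsilon> \<le> \<delta> / 2"
  proof -
    show "0 < \<epsilon>" using \<delta> by (simp add: \<epsilon>_def add_nonneg_pos)
    then have "lam * \<epsilon> \<le> (\<bar>lam\<bar> + 1) * \<epsilon>" by (intro mult_right_mono) auto
    also have "\<dots> = \<delta> / 2" unfolding \<epsilon>_def by (simp add: field_simps add_nonneg_eq_0_iff)
    finally show "lam * \<epsilon> \<le> \<delta> / 2" .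
  qed
  define A where "A = (\<integral>x. U x \<partial>lborel) + \<epsilon> * measure lebesgue V"
  have "0 < measure lebesgue V" by (rule measure_open_pos[OF V])
  then have A0: "0 < A"
    unfolding A_def using \<epsilon>(1) U(2) by (intro add_nonneg_pos Bochner_Integration.integral_nonneg mult_pos_pos)
  have bound: "lam * (LINT x|lebesgue_on V. (norm (\<phi> n x))\<^sup>2) + \<delta> / 2 * ((LINT x|lebesgue_on V. 1 \<bullet> \<phi> n x)\<^sup>2 / A)
      \<le> (LINT x|lebesgue_on V. (norm (grad (\<phi> n) x))\<^sup>2)" for n
  proof -
    have sq: "(LINT x|lebesgue_on V. (\<psi> x)\<^sup>2) = (\<integral>x. (\<psi> x)\<^sup>2 \<partial>lborel)"
      "integrable (lebesgue_on V) (\<lambda>x. (\<psi> x)\<^sup>2)" "integrable lborel (\<lambda>x. (\<psi> x)\<^sup>2)"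
      if "\<psi> \<in> test_functions V" for \<psi>
      using LINT_lebesgue_on_test[OF test_functions_mult[OF that test_functionsD(1)[OF that]] Vs]
        test_functions_integrable[OF test_functions_mult[OF that test_functionsD(1)[OF that]]]
      by (simp_all add: power2_eq_square)
    have "(LINT x|lebesgue_on V. (norm (grad (\<phi> n) x))\<^sup>2) = (\<integral>x. (\<Sum>b\<in>Basis. (dderiv b (\<phi> n) x)\<^sup>2) \<partial>lborel)"
      using sq[OF test_functions_dderiv[OF \<phi>]] by (simp add: norm_grad)
    with supersolution_energy_bound[OF V(1,2) U super \<phi> \<epsilon> \<delta> A_def A0, of n]
    show ?thesis
      using sq[OF \<phi>] LINT_lebesgue_on_test(1)[OF \<phi> Vs] by simp
  qed
  \<comment> \<open>\<open>A\<close> does not depend on \<open>n\<close>, so the gain term persists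
    in the limit.\<close>
  have "lam * ?E + \<delta> / 2 * (?m\<^sup>2 / A) \<le> ?G"
  proof (rule LIMSEQ_le)
    have "(\<lambda>n. LINT x|lebesgue_on V. 1 \<bullet> \<phi> n x) \<longlonglongrightarrow> (LINT x|lebesgue_on V. 1 \<bullet> e x)"
      by (rule L2_tendsto_inner[OF \<phi>L(1) eL lim' L2_const[OF V(2)]])
    moreover have "(\<lambda>n. LINT x|lebesgue_on V. (norm (\<phi> n x))\<^sup>2) \<longlonglongrightarrow> (LINT x|lebesgue_on V. (norm (e x))\<^sup>2)"
      by (rule L2_tendsto_norm[OF \<phi>L(1) eL lim'])
    ultimately show "(\<lambda>n. lam * (LINT x|lebesgue_on V. (norm (\<phi> n x))\<^sup>2)
        + \<delta> / 2 * ((LINT x|lebesgue_on V. 1 \<bullet> \<phi> n x)\<^sup>2 / A)) \<longlonglongrightarrow> lam * ?E + \<delta> / 2 * (?m\<^sup>2 / A)"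
      using A0 by (auto intro!: tendsto_intros)
    show "(\<lambda>n. LINT x|lebesgue_on V. (norm (grad (\<phi> n) x))\<^sup>2) \<longlonglongrightarrow> ?G"
      by (rule L2_tendsto_norm[OF \<phi>L(2) g(1) lim(2)])
  qed (use bound in blast)
  moreover have "0 < \<delta> / 2 * (?m\<^sup>2 / A)" using \<delta> A0 e(2) by simp
  ultimately show False using energy by linarith
qed

section \<open>Reduction of the semilinear equation to a linear inequality\<close>

text \<open>\<open>GREATEST\<close> is meaningful only if the maximum is attained. Beyond
  \<open>T\<close> the power dominates and the value is at most the one at 0; on
  \<open>{0..T}\<close> compactness applies.\<close>

lemma greatest_subcritical_bound:
  fixes lam p t :: real
  assumes p: "1 < p" and t: "0 \<le> t"
  shows "lam * t - t powr p \<le> (GREATEST m. \<exists>t\<ge>0. m = lam * t - t powr p)"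
proof -
  let ?f = "\<lambda>t. lam * t - t powr p"
  \<comment> \<open>Solves \<open>T powr (p - 1) = \<bar>lam\<bar>\<close>, so
    \<open>t powr p\<close> dominates \<open>\<bar>lam\<bar> * t\<close> from here on.\<close>
  define T where "T = \<bar>lam\<bar> powr (1 / (p - 1))"
  have T: "0 \<le> T" by (simp add: T_def)
  have big: "?f t \<le> ?f 0" if "T \<le> t" for t
  proof -
    have t0: "0 \<le> t" using T that by linarith
    have "\<bar>lam\<bar> = T powr (p - 1)" using p by (simp add: T_def powr_powr)
    also have "\<dots> \<le> t powr (p - 1)" using that T p by (intro powr_mono2) auto
    finally have "\<bar>lam\<bar> * t \<le> t powr (p - 1) * t" using t0 by (rule mult_right_mono)
    also have "\<dots> = t powr p" using t0 powr_mult_base[of t "p - 1"] by (simp add: mult.commute)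
    finally have "\<bar>lam\<bar> * t \<le> t powr p" .
    moreover have "lam * t \<le> \<bar>lam\<bar> * t" using t0 by (intro mult_right_mono) auto
    ultimately show ?thesis by simp
  qed
  have "continuous_on {0..T} ?f"
    using p by (intro continuous_intros continuous_on_powr') auto
  then obtain t0 where t0: "t0 \<in> {0..T}" "\<And>t. t \<in> {0..T} \<Longrightarrow> ?f t \<le> ?f t0"
    using continuous_attains_sup[of "{0..T}" ?f] T by auto
  have max: "?f t \<le> ?f t0" if "0 \<le> t" for t
  proof (cases "t \<le> T")
    case False
    then have "?f t \<le> ?f 0" by (intro big) auto
    also have "\<dots> \<le> ?f t0" using T by (intro t0(2)) auto
    finally show ?thesis .
  qed (use that t0 in auto)
  have "(GREATEST m. \<exists>t\<ge>0. m = ?f t) = ?f t0"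
    by (rule Greatest_equality) (use t0 max in auto)
  then show ?thesis using max[OF t] by simp
qed

lemma AE_ge_ess_inf_on: "AE x in lebesgue_on S. ess_inf_on S f \<le> ereal (f x)"
proof -
  have "AE x in lebesgue_on S. - ereal (f x) \<le> esssup (lebesgue_on S) (\<lambda>x. - ereal (f x))"
    by (rule esssup_AE)
  then show ?thesis
    unfolding ess_inf_on_def by eventually_elim (simp add: ereal_uminus_le_reorder)
qed

lemma AE_le_ess_sup_on: "AE x in lebesgue_on S. ereal (f x) \<le> ess_sup_on S f"
  unfolding ess_sup_on_def by (rule esssup_AE)

text \<open>A nonnegative function with zero integral vanishes almost everywhere, and a nonempty
  open set is not null.\<close>

lemma LINT_pos_nonzero:
  fixes f :: "'a::euclidean_space \<Rightarrow> real"
  assumes V: "open V" "V \<noteq> {}" and f: "integrable (lebesgue_on V) f" "\<And>x. x \<in> V \<Longrightarrow> 0 < f x"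
  shows "(LINT x|lebesgue_on V. f x) \<noteq> 0"
proof
  assume "(LINT x|lebesgue_on V. f x) = 0"
  moreover have "AE x in lebesgue_on V. 0 \<le> f x"
    using f(2) by (intro AE_I2) (auto simp: space_restrict_space intro: less_imp_le)
  ultimately have "AE x in lebesgue_on V. f x = 0"
    using f(1) by (simp add: integral_nonneg_eq_0_iff_AE)
  then have "AE x in lebesgue. x \<in> V \<longrightarrow> f x = 0"
    using V(1) by (simp add: AE_restrict_space_iff)
  then have "AE x\<in>V in lebesgue. x \<in> {}"
    by eventually_elim (use f(2) in force)
  moreover obtain x where "x \<in> V" using V(2) by blast
  ultimately show False using mem_closed_if_AE_lebesgue_open[OF V(1), of "{}" x] by auto
qed

lemma AE_lebesgue_on_iff:
  "S \<in> sets lebesgue \<Longrightarrow> (AE x in lebesgue_on S. P x) \<longleftrightarrow> (AE x in lebesgue. x \<in> S \<longrightarrow> P x)"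
  by (simp add: AE_restrict_space_iff)

text \<open>The sign \<open>s\<close> of \<open>e\<close> on \<open>V\<close> reduces the case of negative \<open>e\<close> to that of positive \<open>e\<close>.\<close>

lemma no_solution_with_sign_of_eigenfunction:
  fixes \<Omega> V :: "'a::euclidean_space set" and u e w :: "'a \<Rightarrow> real" and s p lam :: real
  defines "f \<equiv> \<lambda>x. \<bar>u x\<bar> powr (p - 1) * u x + w x"
  assumes \<Omega>: "open \<Omega>" "bounded \<Omega>" and p: "1 < p"
    and e: "weak_poisson \<Omega> e (\<lambda>x. lam * e x)" "e \<in> H10 V"
    and V: "open V" "V \<noteq> {}" "V \<subseteq> \<Omega>"
    and s: "\<bar>s\<bar> = 1" "\<And>x. x \<in> V \<Longrightarrow> 0 < s * e x"
    and ew: "AE x in lebesgue_on \<Omega>. 0 \<le> e x * w x"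
    and w: "ereal (GREATEST m. \<exists>t\<ge>0. m = lam * t - t powr p) < ess_inf_on \<Omega> (\<lambda>x. \<bar>w x\<bar>)"
    and u: "u \<in> L2 \<Omega>" "AE x in lebesgue_on V. 0 \<le> u x * e x" "weak_poisson U u f" "V \<subseteq> U" "open U"
  shows False
proof -
  define M where "M = (GREATEST m. \<exists>t\<ge>0. m = lam * t - t powr p)"
  have Vm: "V \<in> lmeasurable" "V \<in> sets lebesgue" "\<Omega> \<in> sets lebesgue" "U \<in> sets lebesgue"
    using V \<Omega> u(5) bounded_subset by (auto intro: lmeasurable_open)
  \<comment> \<open>The essential infimum is an \<open>ereal\<close>; an intermediate real level
    yields a real gap \<open>\<delta>\<close>.\<close>
  obtain c where c: "M < c" "ereal c < ess_inf_on \<Omega> (\<lambda>x. \<bar>w x\<bar>)"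
    using ereal_dense2[OF w] by (auto simp: M_def)
  define \<delta> where "\<delta> = c - M"
  have \<delta>: "0 < \<delta>" using c(1) by (simp add: \<delta>_def)
  have "AE x in lebesgue_on \<Omega>. c \<le> \<bar>w x\<bar>"
    using AE_ge_ess_inf_on[of \<Omega> "\<lambda>x. \<bar>w x\<bar>"]
  proof eventually_elim
    case (elim x)
    with c(2) have "ereal c < ereal \<bar>w x\<bar>" by (rule less_le_trans)
    then show ?case by simp
  qed
  then have "AE x in lebesgue. x \<in> \<Omega> \<longrightarrow> c \<le> \<bar>w x\<bar>" "AE x in lebesgue. x \<in> \<Omega> \<longrightarrow> 0 \<le> e x * w x"
    "AE x in lebesgue. x \<in> V \<longrightarrow> 0 \<le> u x * e x"
    using ew u(2) Vm by (simp_all add: AE_lebesgue_on_iff)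
  \<comment> \<open>Here the nonlinearity disappears: \<open>s * f x\<close> equals
    \<open>\<bar>u x\<bar> powr p + \<bar>w x\<bar>\<close>, and the maximum \<open>M\<close> trades
    the power for the linear term.\<close>
  then have ae: "AE x in lebesgue. x \<in> V \<longrightarrow> 0 \<le> s * u x \<and> lam * (s * u x) + \<delta> \<le> s * f x"
  proof eventually_elim
    case (elim x)
    show ?case
    proof (intro impI)
      assume x: "x \<in> V"
      have "s = 1 \<or> s = -1" using s(1) by linarith
      \<comment> \<open>\<open>u x\<close> and \<open>w x\<close> weakly share the sign
        \<open>s\<close> of \<open>e x\<close>, so multiplying by \<open>s\<close> gives absolute
        values.\<close>
      then have su: "s * u x = \<bar>u x\<bar>" and sw: "s * w x = \<bar>w x\<bar>"
        using elim x V(3) s(2)[OF x] by (auto simp: zero_le_mult_iff mult_less_0_iff)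
      have "s * f x = \<bar>u x\<bar> powr (p - 1) * (s * u x) + s * w x"
        by (simp add: f_def algebra_simps)
      also have "\<dots> = \<bar>u x\<bar> powr p + \<bar>w x\<bar>"
        unfolding su sw using powr_mult_base[of "\<bar>u x\<bar>" "p - 1"] by (simp add: mult.commute)
      finally have "s * f x = \<bar>u x\<bar> powr p + \<bar>w x\<bar>" .
      moreover have "lam * \<bar>u x\<bar> - \<bar>u x\<bar> powr p \<le> M"
        unfolding M_def by (rule greatest_subcritical_bound[OF p]) simp
      moreover have "c \<le> \<bar>w x\<bar>" using elim x V(3) by auto
      ultimately show "0 \<le> s * u x \<and> lam * (s * u x) + \<delta> \<le> s * f x"
        unfolding su \<delta>_def by simp
    qed
  qed
  define h where "h x = s * (indicator V x * u x)" for x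
  have "integrable (lebesgue_on V) u"
    using L2_integrable[OF Vm(1) L2_mono[OF u(1) V(3) Vm(2,3)]] .
  then have h: "integrable lebesgue h"
    unfolding h_def using Vm(2) by (simp add: integrable_restrict_space)
  \<comment> \<open>\<open>h\<close> is Lebesgue measurable and nonnegative only almost everywhere;
    the positive part of a Borel version is nonnegative everywhere and integrable for
    \<open>lborel\<close>.\<close>
  then obtain h' where h': "h' \<in> borel_measurable lborel" "AE x in lborel. h x = h' x"
    using completion_ex_borel_measurable_real[OF borel_measurable_integrable] by blast
  define v where "v x = max 0 (h' x)" for x
  have vm: "v \<in> borel_measurable lborel" unfolding v_def using h'(1) by measurable
  have v_eq: "AE x in lebesgue. v x = h x"
    using AE_completion[OF h'(2)] ae
  proof eventually_elim
    case (elim x)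
    then have "0 \<le> h x" by (cases "x \<in> V") (auto simp: h_def)
    with elim(1) show ?case by (simp add: v_def)
  qed
  have "integrable lebesgue v"
    using h vm v_eq by (subst integrable_cong_AE[where g = h]) (auto simp: measurable_completion)
  then have v: "integrable lborel v" using vm by (simp add: integrable_completion)
  have eL: "e \<in> L2 V" using e(2) by (simp add: H10_def)
  show False
  proof (rule no_nonneg_supersolution[OF V(1) Vm(1) V(2) e(2) _ _ v _ \<delta>])
    have "(LINT x|lebesgue_on V. s * e x) \<noteq> 0"
      using L2_integrable[OF Vm(1) eL] by (intro LINT_pos_nonzero V s(2)) auto
    then show "(LINT x|lebesgue_on V. e x) \<noteq> 0" by auto
    show "(LINT x|lebesgue_on V. e x * laplacian \<phi> x) = - (LINT x|lebesgue_on V. lam * e x * \<phi> x)"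
      if "\<phi> \<in> test_functions V" for \<phi>
      by (rule weak_poisson_laplacian[OF e(1) V(3) Vm(2,3) that])
    show "0 \<le> v x" for x by (simp add: v_def)
    fix \<psi> assume \<psi>: "\<psi> \<in> test_functions V" and \<psi>0: "\<And>x. 0 \<le> \<psi> x"
    have i\<psi>: "integrable lborel \<psi>" by (rule test_functions_integrable[OF \<psi>])
    have iv\<psi>: "integrable lborel (\<lambda>x. v x * \<psi> x)"
      using test_functions_bounded[OF \<psi>] v i\<psi> by (metis borel_measurable_integrable integrable_mult_bounded)
    have lap: "laplacian \<psi> \<in> borel_measurable lborel"
      unfolding laplacian_def[abs_def]
      using smooth_on_borel[OF smooth_on_dderiv[OF smooth_on_dderiv[OF test_functionsD(1)[OF \<psi>]]]]
      by measurable
    have lf: "locally_integrable V f"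
      using u(3,4) by (auto simp: weak_poisson_def locally_integrable_def)
    have if\<psi>: "integrable lebesgue (\<lambda>x. s * (f x * \<psi> x))"
      using test_functions_integrable_mult[OF \<psi> lf] by (simp add: mult.commute)
    have "lam * (\<integral>x. v x * \<psi> x \<partial>lborel) + \<delta> * (\<integral>x. \<psi> x \<partial>lborel)
        = (\<integral>x. lam * (v x * \<psi> x) + \<delta> * \<psi> x \<partial>lborel)"
      using iv\<psi> i\<psi> by simp
    \<comment> \<open>The chain moves to the completed measure because \<open>f\<close> and
      \<open>u\<close> are only Lebesgue measurable, and returns to \<open>lborel\<close> once
      \<open>v\<close> has replaced \<open>h\<close>.\<close>
    also have "\<dots> = (LINT x|lebesgue. lam * (v x * \<psi> x) + \<delta> * \<psi> x)"
      using iv\<psi> i\<psi> by (intro integral_completion[symmetric]) auto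
    also have "\<dots> \<le> (LINT x|lebesgue. s * (f x * \<psi> x))"
    proof (rule integral_mono_AE)
      show "integrable lebesgue (\<lambda>x. lam * (v x * \<psi> x) + \<delta> * \<psi> x)"
        using iv\<psi> i\<psi> by (subst integrable_completion) auto
      show "AE x in lebesgue. lam * (v x * \<psi> x) + \<delta> * \<psi> x \<le> s * (f x * \<psi> x)"
        using v_eq ae
      proof eventually_elim
        case (elim x)
        show ?case
        proof (cases "x \<in> V")
          case True
          with elim have "(lam * v x + \<delta>) * \<psi> x \<le> s * f x * \<psi> x"
            by (intro mult_right_mono \<psi>0) (simp add: h_def)
          then show ?thesis by (simp add: algebra_simps)
        qed (simp add: test_functions_zero[OF \<psi>])
      qed
    qed (rule if\<psi>)
    also have "\<dots> = s * (LINT x|lebesgue_on V. f x * \<psi> x)"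
      using test_functions_zero[OF \<psi>] by (simp add: LINT_lebesgue_on_eq[OF Vm(2)])
    \<comment> \<open>The equation for \<open>u\<close> enters here, with both derivatives on
      \<open>\<psi>\<close>.\<close>
    also have "\<dots> = - (s * (LINT x|lebesgue_on V. u x * laplacian \<psi> x))"
      by (simp add: weak_poisson_laplacian[OF u(3,4) Vm(2,4) \<psi>])
    also have "s * (LINT x|lebesgue_on V. u x * laplacian \<psi> x) = (LINT x|lebesgue. s * (u x * laplacian \<psi> x))"
      using laplacian_zero_outside[OF \<psi>] by (simp add: LINT_lebesgue_on_eq[OF Vm(2)])
    also have "\<dots> = (LINT x|lebesgue. h x * laplacian \<psi> x)"
    proof (rule Bochner_Integration.integral_cong)
      show "s * (u x * laplacian \<psi> x) = h x * laplacian \<psi> x" for x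
        using laplacian_zero_outside[OF \<psi>, of x] by (cases "x \<in> V") (auto simp: h_def)
    qed simp
    also have "\<dots> = (LINT x|lebesgue. v x * laplacian \<psi> x)"
    proof (rule integral_cong_AE)
      have [measurable]: "laplacian \<psi> \<in> borel_measurable lebesgue"
        using lap by (simp add: measurable_completion)
      show "(\<lambda>x. h x * laplacian \<psi> x) \<in> borel_measurable lebesgue"
        using h by measurable
      show "(\<lambda>x. v x * laplacian \<psi> x) \<in> borel_measurable lebesgue"
        using measurable_completion[OF vm] by measurable
      show "AE x in lebesgue. h x * laplacian \<psi> x = v x * laplacian \<psi> x"
        using v_eq by eventually_elim simp
    qed
    also have "\<dots> = (\<integral>x. v x * laplacian \<psi> x \<partial>lborel)"
      using vm lap by (intro integral_completion borel_measurable_times) auto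
    finally show "lam * (\<integral>x. v x * \<psi> x \<partial>lborel) + \<delta> * (\<integral>x. \<psi> x \<partial>lborel) \<le>
        - (\<integral>x. v x * laplacian \<psi> x \<partial>lborel)" .
  qed
qed

theorem proposition3p5:
  fixes \<Omega> \<Omega>k :: "'a::euclidean_space set"
    and e w :: "'a \<Rightarrow> real"
    and p lam :: real
  assumes "smooth_bounded_domain \<Omega>"
    and "1 < p"
    and "DIM('a) \<ge> 3 \<Longrightarrow> p < (real DIM('a) + 2) / (real DIM('a) - 2)"
    and "dirichlet_eigenfunction \<Omega> lam e"
    and "w \<in> L2 \<Omega>"
    and "AE x in lebesgue_on \<Omega>. 0 \<le> e x * w x"
    and "ereal (GREATEST m. \<exists>t\<ge>0. m = lam * t - t powr p) < ess_inf_on \<Omega> (\<lambda>x. \<bar>w x\<bar>)"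
    and "nodal_region \<Omega> e \<Omega>k"
  shows "(\<nexists>u. u \<in> H1 \<Omega> \<and> (AE x in lebesgue_on \<Omega>k. 0 \<le> u x * e x) \<and>
            weak_poisson \<Omega>k u (\<lambda>x. \<bar>u x\<bar> powr (p - 1) * u x + w x)) \<and>
         (\<forall>u. u \<in> H10 \<Omega> \<and> weak_poisson \<Omega> u (\<lambda>x. \<bar>u x\<bar> powr (p - 1) * u x + w x) \<longrightarrow>
            ((\<forall>x\<in>\<Omega>k. 0 < e x) \<longrightarrow> ess_inf_on \<Omega>k u < 0) \<and>
            ((\<forall>x\<in>\<Omega>k. e x < 0) \<longrightarrow> 0 < ess_sup_on \<Omega>k u))"
proof -
  have \<Omega>: "open \<Omega>" "bounded \<Omega>" using assms(1) by (auto simp: smooth_bounded_domain_def)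
  have e: "weak_poisson \<Omega> e (\<lambda>x. lam * e x)" using assms(4) by (simp add: dirichlet_eigenfunction_def)
  have V: "open \<Omega>k" "\<Omega>k \<noteq> {}" "\<Omega>k \<subseteq> \<Omega>" "e \<in> H10 \<Omega>k"
    using assms(8) by (auto simp: nodal_region_def)
  obtain s :: real where s: "\<bar>s\<bar> = 1" "\<And>x. x \<in> \<Omega>k \<Longrightarrow> 0 < s * e x"
  proof -
    from assms(8) consider "\<forall>x\<in>\<Omega>k. 0 < e x" | "\<forall>x\<in>\<Omega>k. e x < 0" by (auto simp: nodal_region_def)
    then show thesis
    proof cases
      case 1
      then show ?thesis using that[of 1] by simp
    next
      case 2
      then show ?thesis using that[of "-1"] by simp
    qed
  qed
  \<comment> \<open>\<open>U\<close> stays general because the equation holds on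
    \<open>\<Omega>k\<close> in the first claim and on all of \<open>\<Omega>\<close> in the
    second.\<close>
  have no_solution: False
    if "u \<in> L2 \<Omega>" "AE x in lebesgue_on \<Omega>k. 0 \<le> u x * e x"
      "weak_poisson U u (\<lambda>x. \<bar>u x\<bar> powr (p - 1) * u x + w x)" "\<Omega>k \<subseteq> U" "open U" for u U
    using no_solution_with_sign_of_eigenfunction[OF \<Omega> assms(2) e V(4,1-3) s assms(6,7) that] .
  have sp: "space (lebesgue_on \<Omega>k) = \<Omega>k" by (simp add: space_restrict_space)
  show ?thesis
  proof (intro conjI allI impI notI)
    assume "\<exists>u. u \<in> H1 \<Omega> \<and> (AE x in lebesgue_on \<Omega>k. 0 \<le> u x * e x) \<and>
        weak_poisson \<Omega>k u (\<lambda>x. \<bar>u x\<bar> powr (p - 1) * u x + w x)"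
    then show False using no_solution[OF _ _ _ order.refl V(1)] by (auto simp: H1_def)
  next
    fix u assume u: "u \<in> H10 \<Omega> \<and> weak_poisson \<Omega> u (\<lambda>x. \<bar>u x\<bar> powr (p - 1) * u x + w x)"
    then have "u \<in> L2 \<Omega>" by (simp add: H10_def)
    \<comment> \<open>A solution on \<open>\<Omega>\<close> cannot share the sign of
      \<open>e\<close> almost everywhere on \<open>\<Omega>k\<close>; failure of either claim about
      the extrema would force just that.\<close>
    then have nonneg: "\<not> (AE x in lebesgue_on \<Omega>k. 0 \<le> u x * e x)"
      using no_solution[OF _ _ _ V(3) \<Omega>(1)] u by blast
    show "ess_inf_on \<Omega>k u < 0" if pos: "\<forall>x\<in>\<Omega>k. 0 < e x"
    proof (rule ccontr)
      assume "\<not> ess_inf_on \<Omega>k u < 0"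
      then have ge: "0 \<le> ess_inf_on \<Omega>k u" by simp
      \<comment> \<open>\<open>AE_space\<close> supplies \<open>x \<in> \<Omega>k\<close>, where the
        sign of \<open>e\<close> is known.\<close>
      have "AE x in lebesgue_on \<Omega>k. 0 \<le> u x * e x"
        using AE_ge_ess_inf_on[of \<Omega>k u] AE_space
      proof eventually_elim
        case (elim x)
        with ge have "0 \<le> ereal (u x)" by (meson order_trans)
        then show ?case using elim pos by (simp add: sp less_imp_le)
      qed
      with nonneg show False ..
    qed
    show "0 < ess_sup_on \<Omega>k u" if neg: "\<forall>x\<in>\<Omega>k. e x < 0"
    proof (rule ccontr)
      assume "\<not> 0 < ess_sup_on \<Omega>k u"
      then have le: "ess_sup_on \<Omega>k u \<le> 0" by simp
      have "AE x in lebesgue_on \<Omega>k. 0 \<le> u x * e x"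
        using AE_le_ess_sup_on[of u \<Omega>k] AE_space
      proof eventually_elim
        case (elim x)
        with le have "ereal (u x) \<le> 0" by (meson order_trans)
        then show ?case using elim neg by (simp add: sp mult_nonpos_nonpos less_imp_le)
      qed
      with nonneg show False ..
    qed
  qed
qed

end
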